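(* Let $\mathcal{A}$ be a unital $*$-algebra over $\mathbb{C}$ and let $(M,h')$ be a regular hermitian right $\mathcal{A}$-module such that $M$ is generated by $n$ elements. Define the following invertible hermitian form on the right $\mathcal{A}$-module $\mathcal{A}^n\oplus(\mathcal{A}^n)^*$: $$b:\big(\mathcal{A}^n\oplus(\mathcal{A}^n)^*\big)\times\big(\mathcal{A}^n\oplus(\mathcal{A}^n)^*\big)\to\mathcal{A},\qquad b\big((U,\omega),(V,\eta)\big)=\eta(U)^*+\omega(V)$$ for $U,V\in\mathcal{A}^n$ and $\omega,\eta\in(\mathcal{A}^n)^*$. Then there exists a projection $$\hat p:\mathcal{A}^n\oplus(\mathcal{A}^n)^*\to\mathcal{A}^n\oplus(\mathcal{A}^n)^*,$$ which is orthogonal with respect to $b$, such that the hermitian modules $$\Big(\hat p\big(\mathcal{A}^n\oplus(\mathcal{A}^n)^*\big),\ b|_{\hat p(\mathcal{A}^n\oplus(\mathcal{A}^n)^* )}\Big)\quad\text{and}\quad (M,h')$$ are isometric.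
   Context: A hermitian form on a right $\mathcal{A}$-module $M$ is a map $h:M\times M\to\mathcal{A}$ with $h(m_1,m_2)^*=h(m_2,m_1)$, $h(m_1,m_2a)=h(m_1,m_2)a$ and $h(m_1+m_2,m)=h(m_1,m)+h(m_2,m)$. A right hermitian module is a pair $(M,h)$ of a right $\mathcal{A}$-module and a hermitian form on it. $M^*$ denotes the dual module of right $\mathcal{A}$-module homomorphisms $M\to\mathcal{A}$; it is a left module via $(a\cdot\omega)(m)=a\,\omega(m)$ and is considered here as a right module via $(\omega\cdot a)(m)=a^*\omega(m)$; in $\mathcal{A}^n\oplus(\mathcal{A}^n)^*$ the summand $(\mathcal{A}^n)^*$ carries this right module structure. Let $\hat h:M\to M^*$, $\hat h(m_1)(m_2)=h(m_1,m_2)$; $h$ is invertible if $\hat h$ is a bijection. $(M,h)$ is regular if $M$ is finitely generated projective and $h$ is invertible. A projection is a module endomorphism $p$ with $p^2=p$. An endomorphism $\phi$ of $(M,h)$ is orthogonal with respect to $h$ if $h(\phi(m_1),m_2)=h(m_1,\phi(m_2))$ for all $m_1,m_2\in M$. Two right hermitian modules $(M,h)$, $(M',h')$ are isometric if there is an isomorphism of right modules $\phi:M\to M'$ with $h(m_1,m_2)=h'(\phi(m_1),\phi(m_2))$ for all $m_1,m_2\in M$. *)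

theory Defs
  imports Complex_Main "HOL-Algebra.Module"
begin

section \<open>Unital $*$-algebras over the complex numbers\<close>

record 'a star_algebra = "(complex, 'a) module" +
  star :: "'a \<Rightarrow> 'a"

text \<open>The library locale \<open>algebra\<close> assumes a commutative multiplication, so the algebra axioms are
  spelled out here. Noncommutativity and the zero algebra are both allowed.\<close>

locale star_algebra = ring A for A :: "('a, 'r) star_algebra_scheme" (structure) +
  assumes smult_closed: "x \<in> carrier A \<Longrightarrow> c \<odot> x \<in> carrier A"
    and smult_l_distr: "x \<in> carrier A \<Longrightarrow> (c + d) \<odot> x = c \<odot> x \<oplus> d \<odot> x"
    and smult_r_distr: "\<lbrakk>x \<in> carrier A; y \<in> carrier A\<rbrakk> \<Longrightarrow> c \<odot> (x \<oplus> y) = c \<odot> x \<oplus> c \<odot> y"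
    and smult_assoc1: "x \<in> carrier A \<Longrightarrow> (c * d) \<odot> x = c \<odot> (d \<odot> x)"
    and smult_one: "x \<in> carrier A \<Longrightarrow> 1 \<odot> x = x"
    and smult_assoc2: "\<lbrakk>x \<in> carrier A; y \<in> carrier A\<rbrakk> \<Longrightarrow> (c \<odot> x) \<otimes> y = c \<odot> (x \<otimes> y)"
    and smult_assoc3: "\<lbrakk>x \<in> carrier A; y \<in> carrier A\<rbrakk> \<Longrightarrow> x \<otimes> (c \<odot> y) = c \<odot> (x \<otimes> y)"
    and star_closed: "x \<in> carrier A \<Longrightarrow> star A x \<in> carrier A"
    and star_star: "x \<in> carrier A \<Longrightarrow> star A (star A x) = x"
    and star_add: "\<lbrakk>x \<in> carrier A; y \<in> carrier A\<rbrakk> \<Longrightarrow> star A (x \<oplus> y) = star A x \<oplus> star A y"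
    and star_smult: "x \<in> carrier A \<Longrightarrow> star A (c \<odot> x) = cnj c \<odot> star A x"
    and star_mult: "\<lbrakk>x \<in> carrier A; y \<in> carrier A\<rbrakk> \<Longrightarrow> star A (x \<otimes> y) = star A y \<otimes> star A x"


section \<open>Right modules\<close>

text \<open>As for the left modules of the library, the record extends \<open>ring\<close> only to reuse
  \<open>abelian_group\<close>; the fields \<open>mult\<close> and \<open>one\<close> of a module are irrelevant.\<close>

record ('a, 'm) rmodule = "'m ring" +
  ract :: "'m \<Rightarrow> 'a \<Rightarrow> 'm"  (infixl \<open>\<cdot>\<index>\<close> 70)

locale right_module = A?: ring A + M?: abelian_group M
  for A :: "('a, 'r) ring_scheme" (structure) and M :: "('a, 'm) rmodule" (structure) +
  assumes ract_closed:
      "\<lbrakk>m \<in> carrier M; a \<in> carrier A\<rbrakk> \<Longrightarrow> m \<cdot>\<^bsub>M\<^esub> a \<in> carrier M"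
    and ract_add_scalar:
      "\<lbrakk>m \<in> carrier M; a \<in> carrier A; a' \<in> carrier A\<rbrakk>
        \<Longrightarrow> m \<cdot>\<^bsub>M\<^esub> (a \<oplus>\<^bsub>A\<^esub> a') = m \<cdot>\<^bsub>M\<^esub> a \<oplus>\<^bsub>M\<^esub> m \<cdot>\<^bsub>M\<^esub> a'"
    and ract_add:
      "\<lbrakk>m \<in> carrier M; m' \<in> carrier M; a \<in> carrier A\<rbrakk>
        \<Longrightarrow> (m \<oplus>\<^bsub>M\<^esub> m') \<cdot>\<^bsub>M\<^esub> a = m \<cdot>\<^bsub>M\<^esub> a \<oplus>\<^bsub>M\<^esub> m' \<cdot>\<^bsub>M\<^esub> a"
    and ract_assoc:
      "\<lbrakk>m \<in> carrier M; a \<in> carrier A; a' \<in> carrier A\<rbrakk>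
        \<Longrightarrow> m \<cdot>\<^bsub>M\<^esub> (a \<otimes>\<^bsub>A\<^esub> a') = m \<cdot>\<^bsub>M\<^esub> a \<cdot>\<^bsub>M\<^esub> a'"
    and ract_one:
      "m \<in> carrier M \<Longrightarrow> m \<cdot>\<^bsub>M\<^esub> \<one>\<^bsub>A\<^esub> = m"

definition rmod_hom ::
  "('a, 'r) ring_scheme \<Rightarrow> ('a, 'm) rmodule \<Rightarrow> ('a, 'k) rmodule \<Rightarrow> ('m \<Rightarrow> 'k) set" where
  "rmod_hom A M N = {f \<in> carrier M \<rightarrow> carrier N.
     (\<forall>x\<in>carrier M. \<forall>y\<in>carrier M. f (x \<oplus>\<^bsub>M\<^esub> y) = f x \<oplus>\<^bsub>N\<^esub> f y) \<and>
     (\<forall>x\<in>carrier M. \<forall>a\<in>carrier A. f (x \<cdot>\<^bsub>M\<^esub> a) = f x \<cdot>\<^bsub>N\<^esub> a)}"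

definition rmod_iso ::
  "('a, 'r) ring_scheme \<Rightarrow> ('a, 'm) rmodule \<Rightarrow> ('a, 'k) rmodule \<Rightarrow> ('m \<Rightarrow> 'k) set" where
  "rmod_iso A M N = {f \<in> rmod_hom A M N. bij_betw f (carrier M) (carrier N)}"

definition self_rmod :: "('a, 'r) ring_scheme \<Rightarrow> ('a, 'a) rmodule" where
  "self_rmod A =
    \<lparr>carrier = carrier A, mult = undefined, one = undefined, zero = \<zero>\<^bsub>A\<^esub>,
     add = (\<lambda>x y. x \<oplus>\<^bsub>A\<^esub> y), ract = (\<lambda>x a. x \<otimes>\<^bsub>A\<^esub> a)\<rparr>"

definition direct_sum :: "('a, 'm) rmodule \<Rightarrow> ('a, 'k) rmodule \<Rightarrow> ('a, 'm \<times> 'k) rmodule" where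
  "direct_sum M N =
    \<lparr>carrier = carrier M \<times> carrier N, mult = undefined, one = undefined, zero = (\<zero>\<^bsub>M\<^esub>, \<zero>\<^bsub>N\<^esub>),
     add = (\<lambda>(x, y) (x', y'). (x \<oplus>\<^bsub>M\<^esub> x', y \<oplus>\<^bsub>N\<^esub> y')),
     ract = (\<lambda>(x, y) a. (x \<cdot>\<^bsub>M\<^esub> a, y \<cdot>\<^bsub>N\<^esub> a))\<rparr>"

text \<open>The free right module $\mathcal{A}^{(I)}$ of finitely supported families; functions are
  extensional so that equality in the carrier is equality on \<open>I\<close>.\<close>

definition free_rmod :: "('a, 'r) ring_scheme \<Rightarrow> 'i set \<Rightarrow> ('a, 'i \<Rightarrow> 'a) rmodule" where
  "free_rmod A I =
    \<lparr>carrier = {u \<in> I \<rightarrow>\<^sub>E carrier A. finite {i \<in> I. u i \<noteq> \<zero>\<^bsub>A\<^esub>}},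
     mult = undefined, one = undefined, zero = (\<lambda>i\<in>I. \<zero>\<^bsub>A\<^esub>),
     add = (\<lambda>u v. \<lambda>i\<in>I. u i \<oplus>\<^bsub>A\<^esub> v i),
     ract = (\<lambda>u a. \<lambda>i\<in>I. u i \<otimes>\<^bsub>A\<^esub> a)\<rparr>"

abbreviation free_rmod_rank :: "('a, 'r) ring_scheme \<Rightarrow> nat \<Rightarrow> ('a, nat \<Rightarrow> 'a) rmodule" where
  "free_rmod_rank A n \<equiv> free_rmod A {..<n}"

definition generated_by :: "('a, 'r) ring_scheme \<Rightarrow> ('a, 'm) rmodule \<Rightarrow> nat \<Rightarrow> bool" where
  "generated_by A M n \<longleftrightarrow>
    (\<exists>e \<in> {..<n} \<rightarrow> carrier M. \<forall>m\<in>carrier M. \<exists>a \<in> {..<n} \<rightarrow> carrier A.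
       m = (\<Oplus>\<^bsub>M\<^esub>i\<in>{..<n}. e i \<cdot>\<^bsub>M\<^esub> a i))"

definition finitely_generated :: "('a, 'r) ring_scheme \<Rightarrow> ('a, 'm) rmodule \<Rightarrow> bool" where
  "finitely_generated A M \<longleftrightarrow> (\<exists>n. generated_by A M n)"

text \<open>Projective: a direct summand of a free module. Fixing the types of \<open>I\<close> and \<open>N\<close> loses no
  generality: a projective \<open>M\<close> is a direct summand of the free module on the set \<open>carrier M\<close>,
  with the kernel of the canonical map $\mathcal{A}^{(M)} \to M$ as complement.\<close>

definition projective :: "('a, 'r) ring_scheme \<Rightarrow> ('a, 'm) rmodule \<Rightarrow> bool" where
  "projective A M \<longleftrightarrow>
    (\<exists>(I :: 'm set) (N :: ('a, 'm \<Rightarrow> 'a) rmodule).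
       right_module A N \<and> rmod_iso A (direct_sum M N) (free_rmod A I) \<noteq> {})"

text \<open>The dual $M^*$ as a right module, with $(\omega \cdot a)(m) = a^* \omega(m)$.\<close>

definition dual :: "('a, 'r) star_algebra_scheme \<Rightarrow> ('a, 'm) rmodule \<Rightarrow> ('a, 'm \<Rightarrow> 'a) rmodule" where
  "dual A M =
    \<lparr>carrier = rmod_hom A M (self_rmod A) \<inter> extensional (carrier M),
     mult = undefined, one = undefined, zero = (\<lambda>m\<in>carrier M. \<zero>\<^bsub>A\<^esub>),
     add = (\<lambda>\<omega> \<eta>. \<lambda>m\<in>carrier M. \<omega> m \<oplus>\<^bsub>A\<^esub> \<eta> m),
     ract = (\<lambda>\<omega> a. \<lambda>m\<in>carrier M. star A a \<otimes>\<^bsub>A\<^esub> \<omega> m)\<rparr>"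


section \<open>Hermitian modules\<close>

locale hermitian_module = star_algebra A + right_module A M
  for A :: "('a, 'r) star_algebra_scheme" (structure) and M :: "('a, 'm) rmodule" (structure)
    and h :: "'m \<Rightarrow> 'm \<Rightarrow> 'a" +
  assumes form_closed:
      "\<lbrakk>x \<in> carrier M; y \<in> carrier M\<rbrakk> \<Longrightarrow> h x y \<in> carrier A"
    and form_star:
      "\<lbrakk>x \<in> carrier M; y \<in> carrier M\<rbrakk> \<Longrightarrow> star A (h x y) = h y x"
    and form_ract:
      "\<lbrakk>x \<in> carrier M; y \<in> carrier M; a \<in> carrier A\<rbrakk>
        \<Longrightarrow> h x (y \<cdot>\<^bsub>M\<^esub> a) = h x y \<otimes>\<^bsub>A\<^esub> a"
    and form_add:
      "\<lbrakk>x \<in> carrier M; y \<in> carrier M; z \<in> carrier M\<rbrakk>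
        \<Longrightarrow> h (x \<oplus>\<^bsub>M\<^esub> y) z = h x z \<oplus>\<^bsub>A\<^esub> h y z"

definition form_hat :: "('a, 'm) rmodule \<Rightarrow> ('m \<Rightarrow> 'm \<Rightarrow> 'a) \<Rightarrow> 'm \<Rightarrow> 'm \<Rightarrow> 'a" where
  "form_hat M h = (\<lambda>x. \<lambda>y\<in>carrier M. h x y)"

definition invertible_form ::
  "('a, 'r) star_algebra_scheme \<Rightarrow> ('a, 'm) rmodule \<Rightarrow> ('m \<Rightarrow> 'm \<Rightarrow> 'a) \<Rightarrow> bool" where
  "invertible_form A M h \<longleftrightarrow> bij_betw (form_hat M h) (carrier M) (carrier (dual A M))"

definition regular_hermitian_module ::
  "('a, 'r) star_algebra_scheme \<Rightarrow> ('a, 'm) rmodule \<Rightarrow> ('m \<Rightarrow> 'm \<Rightarrow> 'a) \<Rightarrow> bool" where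
  "regular_hermitian_module A M h \<longleftrightarrow>
    hermitian_module A M h \<and> finitely_generated A M \<and> projective A M \<and> invertible_form A M h"

definition rmod_projection ::
  "('a, 'r) ring_scheme \<Rightarrow> ('a, 'm) rmodule \<Rightarrow> ('m \<Rightarrow> 'm) \<Rightarrow> bool" where
  "rmod_projection A M p \<longleftrightarrow> p \<in> rmod_hom A M M \<and> (\<forall>x\<in>carrier M. p (p x) = p x)"

definition orthogonal_endo :: "('a, 'm) rmodule \<Rightarrow> ('m \<Rightarrow> 'm \<Rightarrow> 'a) \<Rightarrow> ('m \<Rightarrow> 'm) \<Rightarrow> bool" where
  "orthogonal_endo M h f \<longleftrightarrow> (\<forall>x\<in>carrier M. \<forall>y\<in>carrier M. h (f x) y = h x (f y))"

text \<open>The image $f(M)$ of an endomorphism, with the operations of \<open>M\<close>. As hermitian modules are only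
  ever evaluated on the carrier, the restriction of a form to $f(M)$ is the form itself.\<close>

definition image_rmod :: "('m \<Rightarrow> 'm) \<Rightarrow> ('a, 'm) rmodule \<Rightarrow> ('a, 'm) rmodule" where
  "image_rmod f M = M\<lparr>carrier := f ` carrier M\<rparr>"

definition isometric ::
  "('a, 'r) star_algebra_scheme \<Rightarrow> ('a, 'm) rmodule \<Rightarrow> ('m \<Rightarrow> 'm \<Rightarrow> 'a) \<Rightarrow>
     ('a, 'k) rmodule \<Rightarrow> ('k \<Rightarrow> 'k \<Rightarrow> 'a) \<Rightarrow> bool" where
  "isometric A M h M' h' \<longleftrightarrow>
    hermitian_module A M h \<and> hermitian_module A M' h' \<and>
    (\<exists>\<phi> \<in> rmod_iso A M M'. \<forall>x\<in>carrier M. \<forall>y\<in>carrier M. h x y = h' (\<phi> x) (\<phi> y))"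

definition hyperbolic_rmod ::
  "('a, 'r) star_algebra_scheme \<Rightarrow> nat \<Rightarrow> ('a, (nat \<Rightarrow> 'a) \<times> ((nat \<Rightarrow> 'a) \<Rightarrow> 'a)) rmodule" where
  "hyperbolic_rmod A n = direct_sum (free_rmod_rank A n) (dual A (free_rmod_rank A n))"

definition hyperbolic_form ::
  "('a, 'r) star_algebra_scheme \<Rightarrow> 'u \<times> ('u \<Rightarrow> 'a) \<Rightarrow> 'u \<times> ('u \<Rightarrow> 'a) \<Rightarrow> 'a" where
  "hyperbolic_form A = (\<lambda>(U, \<omega>) (V, \<eta>). star A (\<eta> U) \<oplus>\<^bsub>A\<^esub> \<omega> V)"

end

theory Submission
  imports Defs "HOL-Algebra.AbelCoset"
begin

text \<open>A finite dual basis \<open>e, q\<close> of \<open>M\<close> turns \<open>m\<close> into the coordinate vector \<open>(q\<^sub>i m)\<^sub>i\<close>. Pairing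
  it with half of the functional \<open>u \<mapsto> h' m (\<Sum>i. e\<^sub>i u\<^sub>i)\<close> gives an isometric embedding \<open>\<phi>\<close> of \<open>M\<close>
  into the hyperbolic module. Invertibility of \<open>h'\<close> provides an adjoint \<open>\<psi>\<close> of \<open>\<phi>\<close>; then
  \<open>\<psi> \<circ> \<phi> = id\<close>, so \<open>\<phi> \<circ> \<psi>\<close> is an orthogonal projection onto the copy \<open>\<phi>(M)\<close> of \<open>M\<close>.\<close>

section \<open>Additive maps and right modules\<close>

text \<open>The dual summand is what makes the ambient form invertible. Pulling \<open>h'\<close>
  back along \<open>\<pi>: u \<mapsto> \<Sum>i. e\<^sub>i u\<^sub>i\<close> puts a form on the free
  module itself, but that form is degenerate as soon as \<open>\<pi>\<close> has a kernel. In the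
  hyperbolic module the vector part of \<open>\<phi>\<close> is merely a linear section of
  \<open>\<pi>\<close>, and \<open>h'\<close> enters only through the functional part. The form
  pairs vectors with functionals alone, so the section always appears inside \<open>\<pi>\<close>
  and its choice cancels.

  The rank \<open>n\<close> is the main obstacle. It is prescribed by the given generators, whereas
  projectivity only makes \<open>M\<close> a summand of a free module on a possibly infinite set.
  The dual basis extracted from that summand has to be cut down to finitely many members and then
  rewritten over the given generators.

  The same device proves the hyperbolic form invertible: a finite dual basis makes a module
  reflexive, and for the free module the unit vectors and coordinates provide one.\<close>

lemma abelian_group_hom_if_additive:
  assumes "abelian_group M" "abelian_group N" "f \<in> carrier M \<rightarrow> carrier N"
    and "\<And>x y. \<lbrakk>x \<in> carrier M; y \<in> carrier M\<rbrakk> \<Longrightarrow> f (x \<oplus>\<^bsub>M\<^esub> y) = f x \<oplus>\<^bsub>N\<^esub> f y"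
  shows "abelian_group_hom M N f"
  using assms
  by (intro abelian_group_homI group_hom.intro group_hom_axioms.intro)
    (auto simp: hom_def abelian_group.a_group)

lemma (in abelian_group_hom) hom_finsum:
  assumes "finite J" "g \<in> J \<rightarrow> carrier G"
  shows "h (\<Oplus>\<^bsub>G\<^esub>j\<in>J. g j) = (\<Oplus>\<^bsub>H\<^esub>j\<in>J. h (g j))"
  using assms by (induction J) (auto simp: Pi_iff)

text \<open>Additive inverses enter as the action of \<open>\<ominus> \<one>\<close>, an explicit
  element. For a concrete module their existence thus becomes one more equation for the simplifier,
  like the other axioms.\<close>

lemma right_moduleI:
  assumes "ring A"
    and "\<And>x y. \<lbrakk>x \<in> carrier M; y \<in> carrier M\<rbrakk> \<Longrightarrow> x \<oplus>\<^bsub>M\<^esub> y \<in> carrier M"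
    and "\<zero>\<^bsub>M\<^esub> \<in> carrier M"
    and "\<And>x y z. \<lbrakk>x \<in> carrier M; y \<in> carrier M; z \<in> carrier M\<rbrakk>
      \<Longrightarrow> (x \<oplus>\<^bsub>M\<^esub> y) \<oplus>\<^bsub>M\<^esub> z = x \<oplus>\<^bsub>M\<^esub> (y \<oplus>\<^bsub>M\<^esub> z)"
    and "\<And>x y. \<lbrakk>x \<in> carrier M; y \<in> carrier M\<rbrakk> \<Longrightarrow> x \<oplus>\<^bsub>M\<^esub> y = y \<oplus>\<^bsub>M\<^esub> x"
    and "\<And>x. x \<in> carrier M \<Longrightarrow> \<zero>\<^bsub>M\<^esub> \<oplus>\<^bsub>M\<^esub> x = x"
    and inv: "\<And>x. x \<in> carrier M \<Longrightarrow> x \<oplus>\<^bsub>M\<^esub> x \<cdot>\<^bsub>M\<^esub> (\<ominus>\<^bsub>A\<^esub> \<one>\<^bsub>A\<^esub>) = \<zero>\<^bsub>M\<^esub>"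
    and ract: "\<And>m a. \<lbrakk>m \<in> carrier M; a \<in> carrier A\<rbrakk> \<Longrightarrow> m \<cdot>\<^bsub>M\<^esub> a \<in> carrier M"
    and "\<And>m a a'. \<lbrakk>m \<in> carrier M; a \<in> carrier A; a' \<in> carrier A\<rbrakk>
        \<Longrightarrow> m \<cdot>\<^bsub>M\<^esub> (a \<oplus>\<^bsub>A\<^esub> a') = m \<cdot>\<^bsub>M\<^esub> a \<oplus>\<^bsub>M\<^esub> m \<cdot>\<^bsub>M\<^esub> a'"
    and "\<And>m m' a. \<lbrakk>m \<in> carrier M; m' \<in> carrier M; a \<in> carrier A\<rbrakk>
        \<Longrightarrow> (m \<oplus>\<^bsub>M\<^esub> m') \<cdot>\<^bsub>M\<^esub> a = m \<cdot>\<^bsub>M\<^esub> a \<oplus>\<^bsub>M\<^esub> m' \<cdot>\<^bsub>M\<^esub> a"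
    and "\<And>m a a'. \<lbrakk>m \<in> carrier M; a \<in> carrier A; a' \<in> carrier A\<rbrakk>
        \<Longrightarrow> m \<cdot>\<^bsub>M\<^esub> (a \<otimes>\<^bsub>A\<^esub> a') = m \<cdot>\<^bsub>M\<^esub> a \<cdot>\<^bsub>M\<^esub> a'"
    and "\<And>m. m \<in> carrier M \<Longrightarrow> m \<cdot>\<^bsub>M\<^esub> \<one>\<^bsub>A\<^esub> = m"
  shows "right_module A M"
proof -
  interpret A: ring A by fact
  have "\<exists>y\<in>carrier M. y \<oplus>\<^bsub>M\<^esub> x = \<zero>\<^bsub>M\<^esub>" if "x \<in> carrier M" for x
    using that inv[OF that] assms(5)[OF that] ract[OF that, of "\<ominus>\<^bsub>A\<^esub> \<one>\<^bsub>A\<^esub>"] by auto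
  then have "abelian_group M"
    using assms by (intro abelian_groupI) auto
  then show ?thesis
    using assms by (intro right_module.intro right_module_axioms.intro) auto
qed

lemma (in right_module) ract_zero:
  assumes "x \<in> carrier M"
  shows "x \<cdot>\<^bsub>M\<^esub> \<zero>\<^bsub>A\<^esub> = \<zero>\<^bsub>M\<^esub>"
  using ract_add_scalar[of x "\<zero>\<^bsub>A\<^esub>" "\<zero>\<^bsub>A\<^esub>"] ract_closed[of x "\<zero>\<^bsub>A\<^esub>"] assms
  by (simp add: M.add.l_cancel_one)

lemma (in right_module) zero_ract:
  assumes "a \<in> carrier A"
  shows "\<zero>\<^bsub>M\<^esub> \<cdot>\<^bsub>M\<^esub> a = \<zero>\<^bsub>M\<^esub>"
  using ract_add[of "\<zero>\<^bsub>M\<^esub>" "\<zero>\<^bsub>M\<^esub>" a] ract_closed[of "\<zero>\<^bsub>M\<^esub>" a] assms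
  by (simp add: M.add.l_cancel_one)

lemma (in right_module) ract_minus_one:
  assumes "x \<in> carrier M"
  shows "x \<oplus>\<^bsub>M\<^esub> x \<cdot>\<^bsub>M\<^esub> (\<ominus>\<^bsub>A\<^esub> \<one>\<^bsub>A\<^esub>) = \<zero>\<^bsub>M\<^esub>"
proof -
  have "x \<oplus>\<^bsub>M\<^esub> x \<cdot>\<^bsub>M\<^esub> (\<ominus>\<^bsub>A\<^esub> \<one>\<^bsub>A\<^esub>) = x \<cdot>\<^bsub>M\<^esub> (\<one>\<^bsub>A\<^esub> \<oplus>\<^bsub>A\<^esub> \<ominus>\<^bsub>A\<^esub> \<one>\<^bsub>A\<^esub>)"
    using assms by (simp add: ract_add_scalar ract_one)
  then show ?thesis
    using assms by (simp add: A.r_neg ract_zero)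
qed

lemma rmod_homD:
  assumes "f \<in> rmod_hom A M N"
  shows "x \<in> carrier M \<Longrightarrow> f x \<in> carrier N"
    and "\<lbrakk>x \<in> carrier M; y \<in> carrier M\<rbrakk> \<Longrightarrow> f (x \<oplus>\<^bsub>M\<^esub> y) = f x \<oplus>\<^bsub>N\<^esub> f y"
    and "\<lbrakk>x \<in> carrier M; a \<in> carrier A\<rbrakk> \<Longrightarrow> f (x \<cdot>\<^bsub>M\<^esub> a) = f x \<cdot>\<^bsub>N\<^esub> a"
  using assms by (auto simp: rmod_hom_def)

lemma rmod_homI:
  assumes "\<And>x. x \<in> carrier M \<Longrightarrow> f x \<in> carrier N"
    and "\<And>x y. \<lbrakk>x \<in> carrier M; y \<in> carrier M\<rbrakk> \<Longrightarrow> f (x \<oplus>\<^bsub>M\<^esub> y) = f x \<oplus>\<^bsub>N\<^esub> f y"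
    and "\<And>x a. \<lbrakk>x \<in> carrier M; a \<in> carrier A\<rbrakk> \<Longrightarrow> f (x \<cdot>\<^bsub>M\<^esub> a) = f x \<cdot>\<^bsub>N\<^esub> a"
  shows "f \<in> rmod_hom A M N"
  using assms by (auto simp: rmod_hom_def)

lemma rmod_hom_abelian_group_hom:
  assumes "f \<in> rmod_hom A M N" "right_module A M" "right_module A N"
  shows "abelian_group_hom M N f"
  using assms rmod_homD[OF assms(1)]
  by (intro abelian_group_hom_if_additive) (auto simp: right_module_def)

lemma rmod_hom_comp:
  assumes "f \<in> rmod_hom A M N" "g \<in> rmod_hom A N P"
  shows "(\<lambda>x. g (f x)) \<in> rmod_hom A M P"
  using rmod_homD[OF assms(1)] rmod_homD[OF assms(2)] by (auto intro!: rmod_homI)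

lemma rmod_iso_inv:
  assumes "f \<in> rmod_iso A M N" "right_module A M"
  shows "inv_into (carrier M) f \<in> rmod_hom A N M"
proof -
  interpret right_module A M by fact
  have f: "f \<in> rmod_hom A M N" and bij: "bij_betw f (carrier M) (carrier N)"
    using assms(1) by (auto simp: rmod_iso_def)
  let ?g = "inv_into (carrier M) f"
  have g: "?g y \<in> carrier M" "f (?g y) = y" if "y \<in> carrier N" for y
    using bij_betw_inv_into[OF bij] bij_betw_inv_into_right[OF bij] that
    by (auto simp: bij_betw_def)
  have eq: "?g y = x" if "x \<in> carrier M" "f x = y" for x y
    using that bij by (auto simp: bij_betw_def)
  show ?thesis
    by (intro rmod_homI eq) (auto simp: g rmod_homD[OF f] ract_closed)
qed

lemma (in ring) self_rmod: "right_module R (self_rmod R)"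
  by (rule right_moduleI)
    (auto simp: self_rmod_def ring_axioms a_ac m_assoc l_distr r_distr l_minus r_minus r_neg)

lemma direct_sum_right_module:
  assumes "right_module A M" "right_module A N"
  shows "right_module A (direct_sum M N)"
proof -
  interpret M: right_module A M by fact
  interpret N: right_module A N by fact
  show ?thesis
    by (rule right_moduleI)
      (auto simp: direct_sum_def M.A.ring_axioms M.M.a_ac N.M.a_ac M.ract_closed N.ract_closed
        M.ract_add_scalar N.ract_add_scalar M.ract_add N.ract_add M.ract_assoc N.ract_assoc
        M.ract_one N.ract_one M.ract_minus_one N.ract_minus_one)
qed

lemma image_right_module:
  assumes "right_module A M" "f \<in> rmod_hom A M M"
  shows "right_module A (image_rmod f M)"
proof -
  interpret right_module A M by fact
  interpret f: abelian_group_hom M M f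
    using assms by (intro rmod_hom_abelian_group_hom)
  note f = rmod_homD[OF assms(2)]
  have "f x \<oplus>\<^bsub>M\<^esub> f y \<in> f ` carrier M" if "x \<in> carrier M" "y \<in> carrier M" for x y
    using that by (intro image_eqI[of _ _ "x \<oplus>\<^bsub>M\<^esub> y"]) auto
  moreover have "f x \<cdot>\<^bsub>M\<^esub> a \<in> f ` carrier M" if "x \<in> carrier M" "a \<in> carrier A" for x a
    using that by (intro image_eqI[of _ _ "x \<cdot>\<^bsub>M\<^esub> a"]) (auto simp: f ract_closed)
  moreover have "\<zero>\<^bsub>M\<^esub> \<in> f ` carrier M"
    by (intro image_eqI[of _ _ "\<zero>\<^bsub>M\<^esub>"]) auto
  ultimately show ?thesis
    by (intro right_moduleI)
      (auto simp: image_rmod_def A.ring_axioms M.a_ac f ract_closed ract_add_scalar ract_add ract_assoc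
        ract_one ract_minus_one simp del: f.hom_add)
qed


section \<open>Free modules and dual bases\<close>

context ring
begin

lemma free_right_module: "right_module R (free_rmod R I)"
proof (rule right_moduleI)
  fix x y assume xy: "x \<in> carrier (free_rmod R I)" "y \<in> carrier (free_rmod R I)"
  have "{i \<in> I. x i \<oplus> y i \<noteq> \<zero>} \<subseteq> {i \<in> I. x i \<noteq> \<zero>} \<union> {i \<in> I. y i \<noteq> \<zero>}"
    by auto
  then have "finite {i \<in> I. x i \<oplus> y i \<noteq> \<zero>}"
    using xy by (auto simp: free_rmod_def intro: finite_subset)
  moreover have "{i \<in> I. (if i \<in> I then x i \<oplus> y i else undefined) \<noteq> \<zero>} = {i \<in> I. x i \<oplus> y i \<noteq> \<zero>}"
    by auto
  ultimately show "x \<oplus>\<^bsub>free_rmod R I\<^esub> y \<in> carrier (free_rmod R I)"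
    using xy by (auto simp: free_rmod_def PiE_iff restrict_def extensional_def)
next
  fix x a assume xa: "x \<in> carrier (free_rmod R I)" "a \<in> carrier R"
  have "{i \<in> I. x i \<otimes> a \<noteq> \<zero>} \<subseteq> {i \<in> I. x i \<noteq> \<zero>}"
    using xa(2) by auto
  then have "finite {i \<in> I. x i \<otimes> a \<noteq> \<zero>}"
    using xa by (auto simp: free_rmod_def intro: finite_subset)
  moreover have "{i \<in> I. (if i \<in> I then x i \<otimes> a else undefined) \<noteq> \<zero>} = {i \<in> I. x i \<otimes> a \<noteq> \<zero>}"
    by auto
  ultimately show "x \<cdot>\<^bsub>free_rmod R I\<^esub> a \<in> carrier (free_rmod R I)"
    using xa by (auto simp: free_rmod_def PiE_iff restrict_def extensional_def)
qed (auto simp: free_rmod_def ring_axioms fun_eq_iff restrict_def PiE_iff extensional_def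
    a_ac m_assoc l_distr r_distr l_minus r_minus r_neg)

definition unit_vector :: "'i set \<Rightarrow> 'i \<Rightarrow> 'i \<Rightarrow> 'a" where
  "unit_vector I j = (\<lambda>i\<in>I. if i = j then \<one> else \<zero>)"

lemma unit_vector_closed: "unit_vector I j \<in> carrier (free_rmod R I)"
proof -
  have "{i \<in> I. unit_vector I j i \<noteq> \<zero>} \<subseteq> {j}"
    by (auto simp: unit_vector_def)
  then have "finite {i \<in> I. unit_vector I j i \<noteq> \<zero>}"
    by (rule finite_subset) simp
  then show ?thesis
    by (auto simp: free_rmod_def unit_vector_def)
qed

lemma free_rmod_coordinate_hom:
  assumes "i \<in> I"
  shows "(\<lambda>u. u i) \<in> rmod_hom R (free_rmod R I) (self_rmod R)"
  using assms by (intro rmod_homI) (auto simp: free_rmod_def self_rmod_def)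

text \<open>The target is the ring \<open>R\<close> rather than \<open>self_rmod R\<close>, so that
  values of functionals are summed in \<open>R\<close> itself, where the ring laws apply.\<close>

lemma self_rmod_hom_abelian_group_hom:
  assumes "right_module R M" "f \<in> rmod_hom R M (self_rmod R)"
  shows "abelian_group_hom M R f"
  using assms rmod_homD[OF assms(2)]
  by (intro abelian_group_hom_if_additive)
    (auto simp: right_module_def self_rmod_def intro: is_abelian_group)

lemma free_rmod_expansion:
  assumes u: "u \<in> carrier (free_rmod R I)" and J: "finite J" "J \<subseteq> I"
    and supp: "\<And>i. i \<in> I - J \<Longrightarrow> u i = \<zero>"
  shows "u = (\<Oplus>\<^bsub>free_rmod R I\<^esub>j\<in>J. unit_vector I j \<cdot>\<^bsub>free_rmod R I\<^esub> u j)" (is "u = ?s")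
proof -
  interpret F: right_module R "free_rmod R I" by (rule free_right_module)
  have uc: "u i \<in> carrier R" if "i \<in> I" for i
    using u that by (auto simp: free_rmod_def)
  have mem: "(\<lambda>j. unit_vector I j \<cdot>\<^bsub>free_rmod R I\<^esub> u j) \<in> J \<rightarrow> carrier (free_rmod R I)"
    using uc J by (auto intro!: F.ract_closed unit_vector_closed)
  have "?s \<in> carrier (free_rmod R I)"
    using mem by (rule F.M.finsum_closed)
  then show ?thesis
  proof (intro PiE_ext[of u I "\<lambda>_. carrier R" ?s])
    fix i assume i: "i \<in> I"
    interpret c: abelian_group_hom "free_rmod R I" R "\<lambda>u. u i"
      using free_rmod_coordinate_hom[OF i] free_right_module
      by (rule self_rmod_hom_abelian_group_hom[rotated])
    have "?s i = (\<Oplus>j\<in>J. (unit_vector I j \<cdot>\<^bsub>free_rmod R I\<^esub> u j) i)"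
      using J mem by (rule_tac c.hom_finsum)
    also have "\<dots> = (\<Oplus>j\<in>J. if i = j then u j else \<zero>)"
      using i J uc by (intro finsum_cong') (auto simp: free_rmod_def unit_vector_def)
    also have "\<dots> = u i"
    proof (cases "i \<in> J")
      case True
      then show ?thesis
        using J uc by (intro finsum_singleton) auto
    next
      case False
      then have "(\<Oplus>j\<in>J. if i = j then u j else \<zero>) = (\<Oplus>j\<in>J. \<zero>)"
        by (intro finsum_cong') auto
      then show ?thesis
        using False supp i by simp
    qed
    finally show "u i = ?s i" by simp
  qed (use u in \<open>auto simp: free_rmod_def\<close>)
qed

end

section \<open>Finite dual bases over prescribed generators\<close>

text \<open>If \<open>x j\<close> is the combination of the \<open>e k\<close> with coefficients
  \<open>a k\<close>, then the term of index \<open>j\<close> adds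
  \<open>a k \<otimes> c j m\<close> to the coefficient of \<open>e k\<close>. As a function of
  \<open>m\<close> this stays right linear, because the constant factor stands on the left. The
  induction collects these contributions.\<close>

lemma (in right_module) sum_in_generators:
  assumes "finite J" "x \<in> J \<rightarrow> carrier M"
    and c: "\<And>j. j \<in> J \<Longrightarrow> c j \<in> rmod_hom A M (self_rmod A)"
    and e: "e \<in> K \<rightarrow> carrier M" and K: "finite K"
    and gen: "\<And>m. m \<in> carrier M \<Longrightarrow>
      \<exists>a \<in> K \<rightarrow> carrier A. m = (\<Oplus>\<^bsub>M\<^esub>k\<in>K. e k \<cdot>\<^bsub>M\<^esub> a k)"
  shows "\<exists>q. (\<forall>k\<in>K. q k \<in> rmod_hom A M (self_rmod A)) \<and>
    (\<forall>m\<in>carrier M. (\<Oplus>\<^bsub>M\<^esub>j\<in>J. x j \<cdot>\<^bsub>M\<^esub> c j m) = (\<Oplus>\<^bsub>M\<^esub>k\<in>K. e k \<cdot>\<^bsub>M\<^esub> q k m))"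
  using assms(1-3)
proof (induction J)
  case empty
  have "e k \<cdot>\<^bsub>M\<^esub> \<zero>\<^bsub>A\<^esub> = \<zero>\<^bsub>M\<^esub>" if "k \<in> K" for k
    using that e by (auto intro: ract_zero)
  then have "(\<Oplus>\<^bsub>M\<^esub>k\<in>K. e k \<cdot>\<^bsub>M\<^esub> \<zero>\<^bsub>A\<^esub>) = \<zero>\<^bsub>M\<^esub>"
    by (subst M.finsum_cong'[of K K "\<lambda>_. \<zero>\<^bsub>M\<^esub>"]) (auto simp: M.finsum_zero)
  moreover have "(\<lambda>m. \<zero>\<^bsub>A\<^esub>) \<in> rmod_hom A M (self_rmod A)"
    by (auto intro!: rmod_homI simp: self_rmod_def)
  ultimately show ?case
    by (intro exI[of _ "\<lambda>k m. \<zero>\<^bsub>A\<^esub>"]) auto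
next
  case (insert j J)
  have IH: "\<exists>q. (\<forall>k\<in>K. q k \<in> rmod_hom A M (self_rmod A)) \<and>
    (\<forall>m\<in>carrier M. (\<Oplus>\<^bsub>M\<^esub>j\<in>J. x j \<cdot>\<^bsub>M\<^esub> c j m) = (\<Oplus>\<^bsub>M\<^esub>k\<in>K. e k \<cdot>\<^bsub>M\<^esub> q k m))"
    using insert.prems by (intro insert.IH) auto
  obtain q where q: "\<And>k. k \<in> K \<Longrightarrow> q k \<in> rmod_hom A M (self_rmod A)"
    and sum: "\<And>m. m \<in> carrier M \<Longrightarrow>
      (\<Oplus>\<^bsub>M\<^esub>j\<in>J. x j \<cdot>\<^bsub>M\<^esub> c j m) = (\<Oplus>\<^bsub>M\<^esub>k\<in>K. e k \<cdot>\<^bsub>M\<^esub> q k m)"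
    using IH by blast
  obtain a where a: "a \<in> K \<rightarrow> carrier A" and xj: "x j = (\<Oplus>\<^bsub>M\<^esub>k\<in>K. e k \<cdot>\<^bsub>M\<^esub> a k)"
    using gen[of "x j"] insert.prems(1) by auto
  note cj = rmod_homD[OF insert.prems(2)[of j], simplified self_rmod_def, simplified]
  note qk = rmod_homD[OF q, simplified self_rmod_def, simplified]
  let ?q = "\<lambda>k m. a k \<otimes>\<^bsub>A\<^esub> c j m \<oplus>\<^bsub>A\<^esub> q k m"
  have "?q k \<in> rmod_hom A M (self_rmod A)" if "k \<in> K" for k
    using that a cj qk
    by (intro rmod_homI)
      (auto simp: self_rmod_def A.r_distr A.l_distr A.m_assoc A.a_ac Pi_iff)
  moreover have "(\<Oplus>\<^bsub>M\<^esub>j\<in>insert j J. x j \<cdot>\<^bsub>M\<^esub> c j m) = (\<Oplus>\<^bsub>M\<^esub>k\<in>K. e k \<cdot>\<^bsub>M\<^esub> ?q k m)"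
    if m: "m \<in> carrier M" for m
  proof -
    have cm: "c i m \<in> carrier A" if "i \<in> insert j J" for i
      using rmod_homD(1)[OF insert.prems(2)[OF that] m] by (simp add: self_rmod_def)
    interpret act: abelian_group_hom M M "\<lambda>y. y \<cdot>\<^bsub>M\<^esub> c j m"
      using cm by (intro abelian_group_hom_if_additive M.abelian_group_axioms)
        (auto simp: ract_closed ract_add)
    have "x j \<cdot>\<^bsub>M\<^esub> c j m = (\<Oplus>\<^bsub>M\<^esub>k\<in>K. e k \<cdot>\<^bsub>M\<^esub> a k \<cdot>\<^bsub>M\<^esub> c j m)"
      unfolding xj using K e a by (intro act.hom_finsum) (auto simp: Pi_iff ract_closed)
    moreover have "(\<Oplus>\<^bsub>M\<^esub>k\<in>K. e k \<cdot>\<^bsub>M\<^esub> ?q k m) =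
        (\<Oplus>\<^bsub>M\<^esub>k\<in>K. e k \<cdot>\<^bsub>M\<^esub> a k \<cdot>\<^bsub>M\<^esub> c j m \<oplus>\<^bsub>M\<^esub> e k \<cdot>\<^bsub>M\<^esub> q k m)"
      using e a cm qk m
      by (intro M.finsum_cong') (auto simp: Pi_iff ract_closed ract_assoc ract_add_scalar)
    moreover have "\<dots> = (\<Oplus>\<^bsub>M\<^esub>k\<in>K. e k \<cdot>\<^bsub>M\<^esub> a k \<cdot>\<^bsub>M\<^esub> c j m) \<oplus>\<^bsub>M\<^esub> (\<Oplus>\<^bsub>M\<^esub>k\<in>K. e k \<cdot>\<^bsub>M\<^esub> q k m)"
      using e a cm qk m by (intro M.finsum_addf) (auto simp: Pi_iff ract_closed)
    moreover have "(\<Oplus>\<^bsub>M\<^esub>i\<in>insert j J. x i \<cdot>\<^bsub>M\<^esub> c i m) =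
        x j \<cdot>\<^bsub>M\<^esub> c j m \<oplus>\<^bsub>M\<^esub> (\<Oplus>\<^bsub>M\<^esub>i\<in>J. x i \<cdot>\<^bsub>M\<^esub> c i m)"
      using insert.hyps insert.prems(1) cm by (intro M.finsum_insert) (auto simp: Pi_iff ract_closed)
    ultimately show ?thesis
      by (simp only: sum[OF m])
  qed
  ultimately show ?case
    by (intro exI[of _ ?q]) auto
qed

text \<open>The inclusion \<open>\<iota>\<close> into a free module and its retraction
  \<open>F\<close> yield a dual basis at once: the vectors \<open>F (unit_vector I j)\<close> with
  the coordinates of \<open>\<iota>\<close>. Its index set may be infinite and its vectors are
  unrelated to \<open>e\<close>. Finite generation cures the former,
  \<open>sum_in_generators\<close> the latter.\<close>

lemma (in right_module) projective_dual_basis: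
  assumes "projective A M" and e: "e \<in> K \<rightarrow> carrier M" and K: "finite K"
    and gen: "\<And>m. m \<in> carrier M \<Longrightarrow>
      \<exists>a \<in> K \<rightarrow> carrier A. m = (\<Oplus>\<^bsub>M\<^esub>k\<in>K. e k \<cdot>\<^bsub>M\<^esub> a k)"
  obtains q where "\<And>k. k \<in> K \<Longrightarrow> q k \<in> rmod_hom A M (self_rmod A)"
    and "\<And>m. m \<in> carrier M \<Longrightarrow> m = (\<Oplus>\<^bsub>M\<^esub>k\<in>K. e k \<cdot>\<^bsub>M\<^esub> q k m)"
proof -
  obtain I :: "'m set" and N :: "('a, 'm \<Rightarrow> 'a) rmodule" and f
    where "right_module A N" and iso: "f \<in> rmod_iso A (direct_sum M N) (free_rmod A I)"
    using assms(1) unfolding projective_def by blast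
  then interpret N: right_module A N by simp
  have MN: "right_module A (direct_sum M N)"
    by (intro direct_sum_right_module right_module_axioms N.right_module_axioms)
  let ?F = "free_rmod A I"
  interpret F: right_module A ?F by (rule A.free_right_module)
  define F where "F = (\<lambda>u. fst (inv_into (carrier (direct_sum M N)) f u))"
  define \<iota> where "\<iota> = (\<lambda>m. f (m, \<zero>\<^bsub>N\<^esub>))"
  have f: "f \<in> rmod_hom A (direct_sum M N) ?F"
    and inj: "inj_on f (carrier (direct_sum M N))"
    using iso by (auto simp: rmod_iso_def bij_betw_def)
  have "fst \<in> rmod_hom A (direct_sum M N) M"
    by (intro rmod_homI) (auto simp: direct_sum_def)
  then have F: "F \<in> rmod_hom A ?F M"
    unfolding F_def by (rule rmod_hom_comp[OF rmod_iso_inv[OF iso MN]])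
  have "(\<lambda>m. (m, \<zero>\<^bsub>N\<^esub>)) \<in> rmod_hom A M (direct_sum M N)"
    by (intro rmod_homI) (auto simp: direct_sum_def N.zero_ract)
  then have \<iota>: "\<iota> \<in> rmod_hom A M ?F"
    unfolding \<iota>_def by (rule rmod_hom_comp[OF _ f])
  have F\<iota>: "F (\<iota> m) = m" if "m \<in> carrier M" for m
    using that inj by (simp add: F_def \<iota>_def direct_sum_def)
  have coord: "(\<lambda>m. \<iota> m i) \<in> rmod_hom A M (self_rmod A)" if "i \<in> I" for i
    using rmod_hom_comp[OF \<iota> A.free_rmod_coordinate_hom[OF that]] .
  \<comment> \<open>Every \<open>\<iota> m\<close> is a combination of the finitely many
    \<open>\<iota> (e k)\<close>, so the union of their supports bounds all supports
    simultaneously.\<close>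
  define J where "J = (\<Union>k\<in>K. {i \<in> I. \<iota> (e k) i \<noteq> \<zero>\<^bsub>A\<^esub>})"
  have J: "finite J" "J \<subseteq> I"
    using K e rmod_homD(1)[OF \<iota>] by (auto simp: J_def free_rmod_def Pi_iff)
  have supp: "\<iota> m i = \<zero>\<^bsub>A\<^esub>" if m: "m \<in> carrier M" and i: "i \<in> I - J" for m i
  proof -
    interpret c: abelian_group_hom M A "\<lambda>m. \<iota> m i"
      using i by (intro A.self_rmod_hom_abelian_group_hom coord right_module_axioms) auto
    obtain a where a: "a \<in> K \<rightarrow> carrier A" and m_eq: "m = (\<Oplus>\<^bsub>M\<^esub>k\<in>K. e k \<cdot>\<^bsub>M\<^esub> a k)"
      using gen[OF m] by blast
    have "\<iota> m i = (\<Oplus>\<^bsub>A\<^esub>k\<in>K. \<iota> (e k \<cdot>\<^bsub>M\<^esub> a k) i)"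
      unfolding m_eq using K e a by (intro c.hom_finsum) (auto simp: Pi_iff ract_closed)
    also have "\<dots> = (\<Oplus>\<^bsub>A\<^esub>k\<in>K. \<zero>\<^bsub>A\<^esub>)"
      using e a i coord[THEN rmod_homD(3), of i]
      by (intro A.finsum_cong') (auto simp: Pi_iff J_def self_rmod_def)
    finally show ?thesis by (simp add: A.finsum_zero)
  qed
  have expand: "m = (\<Oplus>\<^bsub>M\<^esub>j\<in>J. F (A.unit_vector I j) \<cdot>\<^bsub>M\<^esub> \<iota> m j)" if m: "m \<in> carrier M" for m
  proof -
    interpret F: abelian_group_hom ?F M F
      by (rule rmod_hom_abelian_group_hom[OF F F.right_module_axioms right_module_axioms])
    have im: "\<iota> m \<in> carrier ?F"
      using \<iota> m by (rule rmod_homD)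
    then have imj: "\<iota> m j \<in> carrier A" if "j \<in> J" for j
      using that J by (auto simp: free_rmod_def)
    have "m = F (\<Oplus>\<^bsub>?F\<^esub>j\<in>J. A.unit_vector I j \<cdot>\<^bsub>?F\<^esub> \<iota> m j)"
      using A.free_rmod_expansion[OF im J supp[OF m]] F\<iota>[OF m] by simp
    also have "\<dots> = (\<Oplus>\<^bsub>M\<^esub>j\<in>J. F (A.unit_vector I j \<cdot>\<^bsub>?F\<^esub> \<iota> m j))"
      using J imj by (intro F.hom_finsum) (auto simp: F.ract_closed A.unit_vector_closed)
    also have "\<dots> = (\<Oplus>\<^bsub>M\<^esub>j\<in>J. F (A.unit_vector I j) \<cdot>\<^bsub>M\<^esub> \<iota> m j)"
      using imj rmod_homD[OF F]
      by (intro M.finsum_cong') (auto simp: A.unit_vector_closed ract_closed)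
    finally show ?thesis .
  qed
  have "\<exists>q. (\<forall>k\<in>K. q k \<in> rmod_hom A M (self_rmod A)) \<and>
    (\<forall>m\<in>carrier M. (\<Oplus>\<^bsub>M\<^esub>j\<in>J. F (A.unit_vector I j) \<cdot>\<^bsub>M\<^esub> \<iota> m j) = (\<Oplus>\<^bsub>M\<^esub>k\<in>K. e k \<cdot>\<^bsub>M\<^esub> q k m))"
    using J rmod_homD(1)[OF F]
    by (intro sum_in_generators[where c = "\<lambda>j m. \<iota> m j"] e K gen)
      (auto simp: A.unit_vector_closed intro: coord)
  then show ?thesis
    using expand that by auto
qed

section \<open>The dual module\<close>

context star_algebra
begin

lemma star_zero: "star A \<zero> = \<zero>"
  using star_add[of \<zero> \<zero>] star_closed[of \<zero>] by (simp add: add.l_cancel_one)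

lemma star_one: "star A \<one> = \<one>"
proof -
  have "star A (star A \<one> \<otimes> \<one>) = star A \<one> \<otimes> star A (star A \<one>)"
    by (intro star_mult star_closed one_closed)
  then show ?thesis
    by (simp add: star_star star_closed)
qed

lemma star_abelian_group_hom: "abelian_group_hom A A (star A)"
  by (intro abelian_group_hom_if_additive is_abelian_group) (auto simp: star_closed star_add)

lemma dualI:
  assumes "\<omega> \<in> extensional (carrier M)"
    and "\<And>m. m \<in> carrier M \<Longrightarrow> \<omega> m \<in> carrier A"
    and "\<And>x y. \<lbrakk>x \<in> carrier M; y \<in> carrier M\<rbrakk> \<Longrightarrow> \<omega> (x \<oplus>\<^bsub>M\<^esub> y) = \<omega> x \<oplus> \<omega> y"
    and "\<And>x a. \<lbrakk>x \<in> carrier M; a \<in> carrier A\<rbrakk> \<Longrightarrow> \<omega> (x \<cdot>\<^bsub>M\<^esub> a) = \<omega> x \<otimes> a"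
  shows "\<omega> \<in> carrier (dual A M)"
  using assms by (auto simp: dual_def self_rmod_def intro!: rmod_homI)

lemma dualD:
  assumes "\<omega> \<in> carrier (dual A M)"
  shows "\<omega> \<in> extensional (carrier M)"
    and "m \<in> carrier M \<Longrightarrow> \<omega> m \<in> carrier A"
    and "\<lbrakk>x \<in> carrier M; y \<in> carrier M\<rbrakk> \<Longrightarrow> \<omega> (x \<oplus>\<^bsub>M\<^esub> y) = \<omega> x \<oplus> \<omega> y"
    and "\<lbrakk>x \<in> carrier M; a \<in> carrier A\<rbrakk> \<Longrightarrow> \<omega> (x \<cdot>\<^bsub>M\<^esub> a) = \<omega> x \<otimes> a"
proof -
  have "\<omega> \<in> rmod_hom A M (self_rmod A)"
    using assms by (simp add: dual_def)
  note h = rmod_homD[OF this, simplified self_rmod_def, simplified]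
  show "m \<in> carrier M \<Longrightarrow> \<omega> m \<in> carrier A"
    and "\<lbrakk>x \<in> carrier M; y \<in> carrier M\<rbrakk> \<Longrightarrow> \<omega> (x \<oplus>\<^bsub>M\<^esub> y) = \<omega> x \<oplus> \<omega> y"
    and "\<lbrakk>x \<in> carrier M; a \<in> carrier A\<rbrakk> \<Longrightarrow> \<omega> (x \<cdot>\<^bsub>M\<^esub> a) = \<omega> x \<otimes> a"
    using h by auto
qed (use assms in \<open>simp add: dual_def\<close>)

lemma dual_simps:
  "\<zero>\<^bsub>dual A M\<^esub> = (\<lambda>m\<in>carrier M. \<zero>)"
  "\<omega> \<oplus>\<^bsub>dual A M\<^esub> \<eta> = (\<lambda>m\<in>carrier M. \<omega> m \<oplus> \<eta> m)"
  "\<omega> \<cdot>\<^bsub>dual A M\<^esub> a = (\<lambda>m\<in>carrier M. star A a \<otimes> \<omega> m)"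
  by (simp_all add: dual_def)

lemma dual_abelian_group_hom:
  assumes "right_module A M" "\<omega> \<in> carrier (dual A M)"
  shows "abelian_group_hom M A \<omega>"
  using assms by (intro self_rmod_hom_abelian_group_hom) (auto simp: dual_def)

text \<open>Multiplying values on the left by \<open>star A a\<close> is a right action because the
  star reverses products. It preserves right linearity of functionals because the new factor stands
  on the opposite side.\<close>

lemma dual_right_module:
  assumes "right_module A M"
  shows "right_module A (dual A M)"
proof -
  interpret M: right_module A M by fact
  \<comment> \<open>The unit laws compare a restricted function with \<open>\<omega>\<close> itself,
    also outside the carrier.\<close>
  have arb: "undefined = \<omega> m" if "\<omega> \<in> carrier (dual A M)" "m \<notin> carrier M" for \<omega> m
    using extensional_arb[OF dualD(1)[OF that(1)] that(2)] by simp
  \<comment> \<open>\<open>right_moduleI\<close> forms inverses by acting with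
    \<open>\<ominus> \<one>\<close>, which on the dual multiplies values by the star of that
    element.\<close>
  have neg: "star A (\<ominus> \<one>) = \<ominus> \<one>"
    using star_abelian_group_hom by (simp add: abelian_group_hom.hom_a_inv star_one)
  show ?thesis
  proof (rule right_moduleI)
    fix \<omega> \<eta> assume *: "\<omega> \<in> carrier (dual A M)" "\<eta> \<in> carrier (dual A M)"
    show "\<omega> \<oplus>\<^bsub>dual A M\<^esub> \<eta> \<in> carrier (dual A M)"
      by (rule dualI) (auto simp: dual_simps dualD[OF *(1)] dualD[OF *(2)] a_ac l_distr M.ract_closed)
    show "\<omega> \<oplus>\<^bsub>dual A M\<^esub> \<eta> = \<eta> \<oplus>\<^bsub>dual A M\<^esub> \<omega>"
      by (auto simp: dual_simps dualD(2)[OF *(1)] dualD(2)[OF *(2)] fun_eq_iff a_comm)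
    fix \<theta> assume \<theta>: "\<theta> \<in> carrier (dual A M)"
    show "\<omega> \<oplus>\<^bsub>dual A M\<^esub> \<eta> \<oplus>\<^bsub>dual A M\<^esub> \<theta> = \<omega> \<oplus>\<^bsub>dual A M\<^esub> (\<eta> \<oplus>\<^bsub>dual A M\<^esub> \<theta>)"
      by (auto simp: dual_simps dualD(2)[OF *(1)] dualD(2)[OF *(2)] dualD(2)[OF \<theta>] fun_eq_iff
          a_assoc)
  next
    fix \<omega> assume \<omega>: "\<omega> \<in> carrier (dual A M)"
    note mem = dualD(2)[OF \<omega>]
    show "\<zero>\<^bsub>dual A M\<^esub> \<oplus>\<^bsub>dual A M\<^esub> \<omega> = \<omega>" "\<omega> \<cdot>\<^bsub>dual A M\<^esub> \<one> = \<omega>"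
      "\<omega> \<oplus>\<^bsub>dual A M\<^esub> \<omega> \<cdot>\<^bsub>dual A M\<^esub> (\<ominus> \<one>) = \<zero>\<^bsub>dual A M\<^esub>"
      by (auto simp: dual_simps mem fun_eq_iff restrict_def star_one neg l_minus r_neg
          intro: arb[OF \<omega>])
    fix a assume a: "a \<in> carrier A"
    show "\<omega> \<cdot>\<^bsub>dual A M\<^esub> a \<in> carrier (dual A M)"
      using a by (intro dualI)
        (auto simp: dual_simps dualD[OF \<omega>] star_closed r_distr m_assoc M.ract_closed)
    show "(\<omega> \<oplus>\<^bsub>dual A M\<^esub> \<eta>) \<cdot>\<^bsub>dual A M\<^esub> a = \<omega> \<cdot>\<^bsub>dual A M\<^esub> a \<oplus>\<^bsub>dual A M\<^esub> \<eta> \<cdot>\<^bsub>dual A M\<^esub> a"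
      if \<eta>: "\<eta> \<in> carrier (dual A M)" for \<eta>
      using a by (auto simp: dual_simps mem dualD(2)[OF \<eta>] fun_eq_iff star_closed r_distr)
    fix a' assume a': "a' \<in> carrier A"
    show "\<omega> \<cdot>\<^bsub>dual A M\<^esub> (a \<oplus> a') = \<omega> \<cdot>\<^bsub>dual A M\<^esub> a \<oplus>\<^bsub>dual A M\<^esub> \<omega> \<cdot>\<^bsub>dual A M\<^esub> a'"
      "\<omega> \<cdot>\<^bsub>dual A M\<^esub> (a \<otimes> a') = \<omega> \<cdot>\<^bsub>dual A M\<^esub> a \<cdot>\<^bsub>dual A M\<^esub> a'"
      using a a' by (auto simp: dual_simps mem fun_eq_iff star_closed star_add star_mult l_distr m_assoc)
  next
    show "\<zero>\<^bsub>dual A M\<^esub> \<in> carrier (dual A M)"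
      by (rule dualI) (auto simp: dual_simps M.ract_closed)
  qed (rule ring_axioms)
qed

text \<open>Applying \<open>\<eta>\<close> to the expansion of \<open>m\<close> gives the sum of the
  \<open>\<eta> (e j) \<otimes> q j m\<close>. Left multiplication by \<open>\<eta> (e j)\<close> is
  the twisted right action of its star, whence the star in the coefficients.\<close>

lemma dual_dual_basis:
  assumes M: "right_module A M" and J: "finite J" and e: "e \<in> J \<rightarrow> carrier M"
    and q: "q \<in> J \<rightarrow> carrier (dual A M)"
    and basis: "\<And>m. m \<in> carrier M \<Longrightarrow> m = (\<Oplus>\<^bsub>M\<^esub>j\<in>J. e j \<cdot>\<^bsub>M\<^esub> q j m)"
    and \<eta>: "\<eta> \<in> carrier (dual A M)"
  shows "\<eta> = (\<Oplus>\<^bsub>dual A M\<^esub>j\<in>J. q j \<cdot>\<^bsub>dual A M\<^esub> star A (\<eta> (e j)))" (is "_ = ?s")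
proof -
  interpret M: right_module A M by fact
  interpret D: right_module A "dual A M" by (rule dual_right_module[OF M])
  interpret \<eta>: abelian_group_hom M A \<eta> by (rule dual_abelian_group_hom[OF M \<eta>])
  have \<eta>e: "\<eta> (e j) \<in> carrier A" if "j \<in> J" for j
    using that e by (auto simp: Pi_iff)
  have qj: "q j \<in> carrier (dual A M)" if "j \<in> J" for j
    using that q by auto
  have mem: "(\<lambda>j. q j \<cdot>\<^bsub>dual A M\<^esub> star A (\<eta> (e j))) \<in> J \<rightarrow> carrier (dual A M)"
    by (auto intro!: D.ract_closed star_closed \<eta>e qj)
  show ?thesis
  proof (rule extensionalityI)
    show "\<eta> \<in> extensional (carrier M)" "?s \<in> extensional (carrier M)"
      using \<eta> D.M.finsum_closed[OF mem] by (auto dest: dualD)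
    fix m assume m: "m \<in> carrier M"
    interpret ev: abelian_group_hom "dual A M" A "\<lambda>\<omega>. \<omega> m"
      using m by (intro abelian_group_hom_if_additive D.M.abelian_group_axioms is_abelian_group)
        (auto simp: dual_simps intro: dualD(2))
    have "\<eta> m = \<eta> (\<Oplus>\<^bsub>M\<^esub>j\<in>J. e j \<cdot>\<^bsub>M\<^esub> q j m)"
      using basis[OF m] by simp
    also have "\<dots> = (\<Oplus>j\<in>J. \<eta> (e j \<cdot>\<^bsub>M\<^esub> q j m))"
      using J e m qj by (intro \<eta>.hom_finsum) (auto simp: Pi_iff intro!: M.ract_closed dualD(2)[OF qj])
    also have "\<dots> = (\<Oplus>j\<in>J. (q j \<cdot>\<^bsub>dual A M\<^esub> star A (\<eta> (e j))) m)"
      using e m \<eta>e qj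
      by (intro finsum_cong')
        (auto simp: dual_simps star_star dualD[OF \<eta>] dualD(2)[OF qj] star_closed Pi_iff)
    also have "\<dots> = ?s m"
      using J mem by (rule ev.hom_finsum[symmetric])
    finally show "\<eta> m = ?s m" .
  qed
qed

end


section \<open>Hermitian modules\<close>

context hermitian_module
begin

lemma form_add_right:
  assumes "x \<in> carrier M" "y \<in> carrier M" "z \<in> carrier M"
  shows "h x (y \<oplus>\<^bsub>M\<^esub> z) = h x y \<oplus>\<^bsub>A\<^esub> h x z"
proof -
  have "h x (y \<oplus>\<^bsub>M\<^esub> z) = star A (h y x \<oplus>\<^bsub>A\<^esub> h z x)"
    using assms form_star[of "y \<oplus>\<^bsub>M\<^esub> z" x] by (simp add: form_add)
  then show ?thesis
    using assms by (simp add: star_add form_closed form_star)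
qed

lemma form_ract_left:
  assumes "x \<in> carrier M" "y \<in> carrier M" "a \<in> carrier A"
  shows "h (x \<cdot>\<^bsub>M\<^esub> a) y = star A a \<otimes>\<^bsub>A\<^esub> h x y"
proof -
  have "h (x \<cdot>\<^bsub>M\<^esub> a) y = star A (h y x \<otimes>\<^bsub>A\<^esub> a)"
    using assms form_star[of y "x \<cdot>\<^bsub>M\<^esub> a"] by (simp add: form_ract ract_closed)
  then show ?thesis
    using assms by (simp add: star_mult form_closed form_star)
qed

lemma form_hat_closed:
  assumes "x \<in> carrier M"
  shows "form_hat M h x \<in> carrier (dual A M)"
  using assms
  by (intro dualI) (auto simp: form_hat_def form_closed form_add_right form_ract ract_closed)

lemma nondegenerate:
  assumes "invertible_form A M h" "x \<in> carrier M" "y \<in> carrier M"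
    and "\<And>z. z \<in> carrier M \<Longrightarrow> h x z = h y z"
  shows "x = y"
proof -
  have "form_hat M h x = form_hat M h y"
    using assms(4) by (auto simp: form_hat_def)
  then show ?thesis
    using assms(1-3) by (auto simp: invertible_form_def bij_betw_def inj_on_def)
qed

text \<open>The surjective half of invertibility, as a Riesz representation;
  \<open>nondegenerate\<close> is the injective half.\<close>

lemma representable:
  assumes "invertible_form A M h" "\<omega> \<in> carrier (dual A M)"
  obtains x where "x \<in> carrier M" "\<And>y. y \<in> carrier M \<Longrightarrow> h x y = \<omega> y"
proof -
  have "\<omega> \<in> form_hat M h ` carrier M"
    using assms by (simp add: invertible_form_def bij_betw_def)
  then obtain x where x: "x \<in> carrier M" and eq: "form_hat M h x = \<omega>"
    by blast
  have "h x y = \<omega> y" if "y \<in> carrier M" for y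
    using fun_cong[OF eq, of y] that by (simp add: form_hat_def)
  with x show ?thesis
    by (rule that)
qed

end

lemma hermitian_module_image:
  assumes "hermitian_module A M h" "f \<in> rmod_hom A M M"
  shows "hermitian_module A (image_rmod f M) h"
proof -
  interpret hermitian_module A M h by fact
  have f: "f x \<in> carrier M" if "x \<in> carrier M" for x
    using rmod_homD(1)[OF assms(2) that] .
  have "hermitian_module_axioms A (image_rmod f M) h"
    by (rule hermitian_module_axioms.intro)
      (auto simp: image_rmod_def f form_closed form_star form_ract form_add)
  then show ?thesis
    by (rule hermitian_module.intro[OF star_algebra_axioms
          image_right_module[OF right_module_axioms assms(2)]])
qed

section \<open>Orthogonal projections from isometric embeddings\<close>

text \<open>The adjoint \<open>\<psi> w\<close> is the vector representing the functional
  \<open>y \<mapsto> b w (\<phi> y)\<close>. For \<open>w = \<phi> x\<close> this functional is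
  \<open>h x\<close>, since \<open>\<phi>\<close> preserves the forms, so uniqueness of
  representatives gives \<open>\<psi> (\<phi> x) = x\<close>.\<close>

lemma isometric_embedding_imp_orthogonal_projection:
  assumes "hermitian_module A H b" and "hermitian_module A M h" and inv: "invertible_form A M h"
    and \<phi>: "\<phi> \<in> rmod_hom A M H"
    and isom: "\<And>x y. \<lbrakk>x \<in> carrier M; y \<in> carrier M\<rbrakk> \<Longrightarrow> b (\<phi> x) (\<phi> y) = h x y"
  obtains p where "rmod_projection A H p" "orthogonal_endo H b p" "isometric A (image_rmod p H) b M h"
proof -
  interpret H: hermitian_module A H b by fact
  interpret M: hermitian_module A M h by fact
  note \<phi>D = rmod_homD[OF \<phi>]
  have "\<exists>x. x \<in> carrier M \<and> (\<forall>y\<in>carrier M. h x y = b w (\<phi> y))" if w: "w \<in> carrier H" for w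
  proof -
    have "(\<lambda>y\<in>carrier M. b w (\<phi> y)) \<in> carrier (dual A M)"
      using w by (intro H.dualI)
        (auto simp: \<phi>D H.form_closed H.form_add_right H.form_ract M.ract_closed)
    then show ?thesis
      by (rule M.representable[OF inv]) auto
  qed
  then obtain \<psi> where \<psi>: "\<And>w. w \<in> carrier H \<Longrightarrow> \<psi> w \<in> carrier M"
    and adj: "\<And>w y. \<lbrakk>w \<in> carrier H; y \<in> carrier M\<rbrakk> \<Longrightarrow> h (\<psi> w) y = b w (\<phi> y)"
    using bchoice[of "carrier H" "\<lambda>w x. x \<in> carrier M \<and> (\<forall>y\<in>carrier M. h x y = b w (\<phi> y))"]
    by blast
  \<comment> \<open>A pointwise choice carries no linearity. It is forced by uniqueness: both sides
    of each law have the same pairing with every vector of \<open>M\<close>.\<close>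
  have \<psi>hom: "\<psi> \<in> rmod_hom A H M"
    by (intro rmod_homI M.nondegenerate[OF inv])
      (auto simp: \<psi> \<phi>D adj M.form_add H.form_add M.form_ract_left H.form_ract_left
        H.ract_closed M.ract_closed)
  have \<psi>\<phi>: "\<psi> (\<phi> x) = x" if "x \<in> carrier M" for x
    using that by (intro M.nondegenerate[OF inv]) (auto simp: \<psi> \<phi>D adj isom)
  let ?p = "\<lambda>w. \<phi> (\<psi> w)"
  have p: "?p \<in> rmod_hom A H H"
    using rmod_hom_comp[OF \<psi>hom \<phi>] .
  have "b (?p w) v = b w (?p v)" if "w \<in> carrier H" "v \<in> carrier H" for w v
  proof -
    \<comment> \<open>The adjunction speaks of \<open>\<phi>\<close> in the second argument only, so
      the form is turned around by the star and back again.\<close>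
    have "b (?p w) v = star A (h (\<psi> v) (\<psi> w))"
      using that by (simp add: adj \<psi> \<phi>D H.form_star)
    also have "\<dots> = b w (?p v)"
      using that by (simp add: M.form_star \<psi> flip: adj)
    finally show ?thesis .
  qed
  then have orth: "orthogonal_endo H b ?p"
    by (simp add: orthogonal_endo_def)
  \<comment> \<open>The isometry is \<open>\<psi>\<close> restricted to the image, with inverse
    \<open>\<phi>\<close>, as \<open>isometric\<close> asks for a map from the image to
    \<open>M\<close>.\<close>
  have "\<psi> \<in> rmod_hom A (image_rmod ?p H) M"
    using rmod_homD[OF \<psi>hom] \<psi> \<phi>D by (intro rmod_homI) (auto simp: image_rmod_def)
  moreover have "bij_betw \<psi> (?p ` carrier H) (carrier M)"
  proof (rule bij_betw_byWitness[where f' = \<phi>])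
    show "\<phi> ` carrier M \<subseteq> ?p ` carrier H"
      using \<psi>\<phi> \<phi>D(1) by (auto intro!: image_eqI[where x = "\<phi> _"])
  qed (auto simp: \<psi>\<phi> \<psi> \<phi>D)
  ultimately have "\<psi> \<in> rmod_iso A (image_rmod ?p H) M"
    by (simp add: rmod_iso_def image_rmod_def)
  moreover have "b x y = h (\<psi> x) (\<psi> y)" if "x \<in> ?p ` carrier H" "y \<in> ?p ` carrier H" for x y
    using that by (auto simp: \<psi> \<psi>\<phi> isom)
  ultimately have "isometric A (image_rmod ?p H) b M h"
    using hermitian_module_image[OF H.hermitian_module_axioms p] M.hermitian_module_axioms
    by (auto simp: isometric_def image_rmod_def)
  then show ?thesis
    using that[of ?p] p orth by (simp add: rmod_projection_def \<psi>\<phi> \<psi>)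
qed


section \<open>Hyperbolic modules\<close>

context star_algebra
begin

text \<open>Taking the star exchanges the two summands. Right linearity in the second argument rests
  on the twisted action: the star of \<open>star A a \<otimes> \<eta> U\<close> is
  \<open>star A (\<eta> U) \<otimes> a\<close>.\<close>

lemma hyperbolic_hermitian:
  assumes "right_module A M"
  shows "hermitian_module A (direct_sum M (dual A M)) (hyperbolic_form A)"
proof -
  interpret M: right_module A M by fact
  interpret D: right_module A "dual A M" by (rule dual_right_module[OF assms])
  have "hermitian_module_axioms A (direct_sum M (dual A M)) (hyperbolic_form A)"
    by (rule hermitian_module_axioms.intro)
      (auto simp: direct_sum_def hyperbolic_form_def dual_simps dualD[where M = M] star_closed
        star_star star_add star_mult l_distr a_ac)
  then show ?thesis
    by (rule hermitian_module.intro[OF star_algebra_axioms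
          direct_sum_right_module[OF assms dual_right_module[OF assms]]])
qed

text \<open>Functionals on the first summand are the elements \<open>\<omega>\<close> by definition.
  Functionals on the second must come from vectors \<open>U\<close>, which is reflexivity of
  \<open>M\<close>; a finite dual basis supplies it.\<close>

lemma hyperbolic_invertible:
  assumes M: "right_module A M" and J: "finite J" and e: "e \<in> J \<rightarrow> carrier M"
    and q: "q \<in> J \<rightarrow> carrier (dual A M)"
    and basis: "\<And>m. m \<in> carrier M \<Longrightarrow> m = (\<Oplus>\<^bsub>M\<^esub>j\<in>J. e j \<cdot>\<^bsub>M\<^esub> q j m)"
  shows "invertible_form A (direct_sum M (dual A M)) (hyperbolic_form A)"
proof -
  interpret M: right_module A M by fact
  interpret D: right_module A "dual A M" by (rule dual_right_module[OF M])
  let ?H = "direct_sum M (dual A M)" and ?b = "hyperbolic_form A"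
  interpret H: hermitian_module A ?H ?b by (rule hyperbolic_hermitian[OF M])
  have carr: "carrier ?H = carrier M \<times> carrier (dual A M)"
    by (simp add: direct_sum_def)
  have qj: "q j \<in> carrier (dual A M)" if "j \<in> J" for j
    using that q by auto
  have zero_dual: "\<omega> \<zero>\<^bsub>M\<^esub> = \<zero>" if "\<omega> \<in> carrier (dual A M)" for \<omega>
    using abelian_group_hom.hom_zero[OF dual_abelian_group_hom[OF M that]] .
  have left: "?b (U, \<omega>) (V, \<zero>\<^bsub>dual A M\<^esub>) = \<omega> V"
    if "U \<in> carrier M" "\<omega> \<in> carrier (dual A M)" "V \<in> carrier M" for U V \<omega>
    using that by (simp add: hyperbolic_form_def dual_simps star_zero dualD)
  have right: "?b (U, \<omega>) (\<zero>\<^bsub>M\<^esub>, \<eta>) = star A (\<eta> U)"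
    if "U \<in> carrier M" "\<omega> \<in> carrier (dual A M)" "\<eta> \<in> carrier (dual A M)" for U \<eta> \<omega>
    using that by (simp add: hyperbolic_form_def star_closed zero_dual dualD)
  have "inj_on (form_hat ?H ?b) (carrier ?H)"
  proof (rule inj_onI,
      clarsimp simp only: carr mem_Times_iff fst_conv snd_conv split_paired_all prod.inject)
    fix U \<omega> U' \<omega>'
    assume U: "U \<in> carrier M" "U' \<in> carrier M"
      and \<omega>: "\<omega> \<in> carrier (dual A M)" "\<omega>' \<in> carrier (dual A M)"
      and eq: "form_hat ?H ?b (U, \<omega>) = form_hat ?H ?b (U', \<omega>')"
    have b_eq: "?b (U, \<omega>) (V, \<eta>) = ?b (U', \<omega>') (V, \<eta>)"
      if "V \<in> carrier M" "\<eta> \<in> carrier (dual A M)" for V \<eta>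
      using fun_cong[OF eq, of "(V, \<eta>)"] that by (simp add: form_hat_def carr)
    have "\<omega> = \<omega>'"
    proof (rule extensionalityI)
      fix V assume "V \<in> carrier M"
      then show "\<omega> V = \<omega>' V"
        using b_eq[of V "\<zero>\<^bsub>dual A M\<^esub>"] U \<omega> by (simp add: left)
    qed (use \<omega> in \<open>auto dest: dualD\<close>)
    moreover have \<eta>_eq: "\<eta> U = \<eta> U'" if \<eta>: "\<eta> \<in> carrier (dual A M)" for \<eta>
    proof -
      have "star A (star A (\<eta> U)) = star A (star A (\<eta> U'))"
        using b_eq[of "\<zero>\<^bsub>M\<^esub>" \<eta>] U \<omega> \<eta> by (simp add: right)
      then show ?thesis
        using U \<eta> by (simp add: star_star dualD)
    qed
    \<comment> \<open>All functionals agree on \<open>U\<close> and \<open>U'\<close>, in particular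
      the coordinates \<open>q j\<close>, which determine a vector.\<close>
    have "(\<Oplus>\<^bsub>M\<^esub>j\<in>J. e j \<cdot>\<^bsub>M\<^esub> q j U) = (\<Oplus>\<^bsub>M\<^esub>j\<in>J. e j \<cdot>\<^bsub>M\<^esub> q j U')"
      using e qj U
      by (intro M.M.finsum_cong')
        (auto simp: Pi_iff \<eta>_eq[OF qj] intro!: M.ract_closed dualD(2)[OF qj])
    then have "U = U'"
      using basis U by metis
    ultimately show "U = U' \<and> \<omega> = \<omega>'" by simp
  qed
  moreover have "\<exists>w\<in>carrier ?H. form_hat ?H ?b w = \<Phi>" if \<Phi>: "\<Phi> \<in> carrier (dual A ?H)" for \<Phi>
  proof -
    have \<Phi>_closed: "\<Phi> (V, \<eta>) \<in> carrier A"
      if "V \<in> carrier M" "\<eta> \<in> carrier (dual A M)" for V \<eta>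
      using that dualD(2)[OF \<Phi>, of "(V, \<eta>)"] by (simp add: direct_sum_def)
    have \<Phi>_add: "\<Phi> (V \<oplus>\<^bsub>M\<^esub> V', \<eta> \<oplus>\<^bsub>dual A M\<^esub> \<eta>') = \<Phi> (V, \<eta>) \<oplus> \<Phi> (V', \<eta>')"
      if "V \<in> carrier M" "V' \<in> carrier M" "\<eta> \<in> carrier (dual A M)" "\<eta>' \<in> carrier (dual A M)"
      for V V' \<eta> \<eta>'
      using that dualD(3)[OF \<Phi>, of "(V, \<eta>)" "(V', \<eta>')"] by (simp add: direct_sum_def)
    have \<Phi>_ract: "\<Phi> (V \<cdot>\<^bsub>M\<^esub> a, \<eta> \<cdot>\<^bsub>dual A M\<^esub> a) = \<Phi> (V, \<eta>) \<otimes> a"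
      if "V \<in> carrier M" "\<eta> \<in> carrier (dual A M)" "a \<in> carrier A" for V \<eta> a
      using that dualD(4)[OF \<Phi>, of "(V, \<eta>)" a] by (simp add: direct_sum_def)
    \<comment> \<open>A preimage \<open>(U, \<omega>)\<close> of \<open>\<Phi>\<close> must satisfy
      \<open>\<omega> V = \<Phi> (V, \<zero>)\<close> and
      \<open>star A (\<eta> U) = \<Phi> (\<zero>, \<eta>)\<close>. The second condition at
      \<open>\<eta> = q j\<close> prescribes the coordinates of \<open>U\<close>, hence its
      formula.\<close>
    define \<omega> where "\<omega> = (\<lambda>V\<in>carrier M. \<Phi> (V, \<zero>\<^bsub>dual A M\<^esub>))"
    define U where "U = (\<Oplus>\<^bsub>M\<^esub>j\<in>J. e j \<cdot>\<^bsub>M\<^esub> star A (\<Phi> (\<zero>\<^bsub>M\<^esub>, q j)))"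
    have sq: "\<Phi> (\<zero>\<^bsub>M\<^esub>, q j) \<in> carrier A" if "j \<in> J" for j
      using qj[OF that] by (simp add: \<Phi>_closed)
    have \<omega>: "\<omega> \<in> carrier (dual A M)"
    proof (rule dualI)
      fix x y assume "x \<in> carrier M" "y \<in> carrier M"
      then show "\<omega> (x \<oplus>\<^bsub>M\<^esub> y) = \<omega> x \<oplus> \<omega> y"
        using \<Phi>_add[of x y "\<zero>\<^bsub>dual A M\<^esub>" "\<zero>\<^bsub>dual A M\<^esub>"] by (simp add: \<omega>_def)
    next
      fix x a assume "x \<in> carrier M" "a \<in> carrier A"
      then show "\<omega> (x \<cdot>\<^bsub>M\<^esub> a) = \<omega> x \<otimes> a"
        using \<Phi>_ract[of x "\<zero>\<^bsub>dual A M\<^esub>" a] by (simp add: \<omega>_def D.zero_ract M.ract_closed)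
    qed (auto simp: \<omega>_def \<Phi>_closed)
    have Uj: "(\<lambda>j. e j \<cdot>\<^bsub>M\<^esub> star A (\<Phi> (\<zero>\<^bsub>M\<^esub>, q j))) \<in> J \<rightarrow> carrier M"
      using e sq by (auto intro!: M.ract_closed star_closed)
    then have U: "U \<in> carrier M"
      unfolding U_def by (rule M.M.finsum_closed)
    have star_U: "star A (\<eta> U) = \<Phi> (\<zero>\<^bsub>M\<^esub>, \<eta>)" if \<eta>: "\<eta> \<in> carrier (dual A M)" for \<eta>
    proof -
      interpret \<eta>: abelian_group_hom M A \<eta> by (rule dual_abelian_group_hom[OF M \<eta>])
      interpret star: abelian_group_hom A A "star A" by (rule star_abelian_group_hom)
      interpret \<Phi>2: abelian_group_hom "dual A M" A "\<lambda>\<eta>. \<Phi> (\<zero>\<^bsub>M\<^esub>, \<eta>)"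
      proof (rule abelian_group_hom_if_additive)
        fix x y assume "x \<in> carrier (dual A M)" "y \<in> carrier (dual A M)"
        then show "\<Phi> (\<zero>\<^bsub>M\<^esub>, x \<oplus>\<^bsub>dual A M\<^esub> y) = \<Phi> (\<zero>\<^bsub>M\<^esub>, x) \<oplus> \<Phi> (\<zero>\<^bsub>M\<^esub>, y)"
          using \<Phi>_add[of "\<zero>\<^bsub>M\<^esub>" "\<zero>\<^bsub>M\<^esub>" x y] by simp
      qed (auto simp: \<Phi>_closed D.M.abelian_group_axioms is_abelian_group)
      have \<Phi>2_ract: "\<Phi> (\<zero>\<^bsub>M\<^esub>, x \<cdot>\<^bsub>dual A M\<^esub> a) = \<Phi> (\<zero>\<^bsub>M\<^esub>, x) \<otimes> a"
        if "x \<in> carrier (dual A M)" "a \<in> carrier A" for x a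
        using \<Phi>_ract[of "\<zero>\<^bsub>M\<^esub>" x a] that by (simp add: M.zero_ract)
      have \<eta>e: "\<eta> (e j) \<in> carrier A" if "j \<in> J" for j
        using that e by (auto simp: Pi_iff)
      have "\<eta> U = (\<Oplus>j\<in>J. \<eta> (e j \<cdot>\<^bsub>M\<^esub> star A (\<Phi> (\<zero>\<^bsub>M\<^esub>, q j))))"
        unfolding U_def using J Uj by (rule \<eta>.hom_finsum)
      then have "star A (\<eta> U) = (\<Oplus>j\<in>J. star A (\<eta> (e j \<cdot>\<^bsub>M\<^esub> star A (\<Phi> (\<zero>\<^bsub>M\<^esub>, q j)))))"
        using J Uj by (simp, intro star.hom_finsum) (auto simp: Pi_iff)
      \<comment> \<open>The star moves \<open>\<eta> (e j)\<close> to the right of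
        \<open>\<Phi> (\<zero>, q j)\<close>, where linearity of \<open>\<Phi>\<close> absorbs it as
        the twisted action on \<open>q j\<close>. What remains inside \<open>\<Phi>\<close> is the
        dual expansion of \<open>\<eta>\<close>.\<close>
      also have "\<dots> = (\<Oplus>j\<in>J. \<Phi> (\<zero>\<^bsub>M\<^esub>, q j \<cdot>\<^bsub>dual A M\<^esub> star A (\<eta> (e j))))"
        using e \<eta>e sq qj
        by (intro finsum_cong')
          (auto simp: dualD[OF \<eta>] \<Phi>2_ract star_closed star_mult star_star Pi_iff)
      also have "\<dots> = \<Phi> (\<zero>\<^bsub>M\<^esub>, \<Oplus>\<^bsub>dual A M\<^esub>j\<in>J. q j \<cdot>\<^bsub>dual A M\<^esub> star A (\<eta> (e j)))"
        using J \<eta>e qj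
        by (intro \<Phi>2.hom_finsum[symmetric]) (auto intro!: D.ract_closed star_closed)
      also have "\<dots> = \<Phi> (\<zero>\<^bsub>M\<^esub>, \<eta>)"
        using dual_dual_basis[OF M J e q basis \<eta>] by simp
      finally show ?thesis .
    qed
    have "form_hat ?H ?b (U, \<omega>) = \<Phi>"
    proof (rule extensionalityI)
      fix v assume "v \<in> carrier ?H"
      then obtain V \<eta> where v: "v = (V, \<eta>)" and V: "V \<in> carrier M" and \<eta>: "\<eta> \<in> carrier (dual A M)"
        by (auto simp: carr)
      have "\<Phi> (V, \<eta>) = \<Phi> (\<zero>\<^bsub>M\<^esub>, \<eta>) \<oplus> \<Phi> (V, \<zero>\<^bsub>dual A M\<^esub>)"
        using \<Phi>_add[of "\<zero>\<^bsub>M\<^esub>" V \<eta> "\<zero>\<^bsub>dual A M\<^esub>"] V \<eta> by simp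
      then show "form_hat ?H ?b (U, \<omega>) v = \<Phi> v"
        using V \<eta> by (simp add: v form_hat_def carr hyperbolic_form_def star_U) (simp add: \<omega>_def)
    qed (use \<Phi> in \<open>auto simp: form_hat_def dest: dualD\<close>)
    then show ?thesis
      using U \<omega> by (auto simp: carr)
  qed
  ultimately show ?thesis
    using H.form_hat_closed by (auto simp: invertible_form_def bij_betw_def image_iff)
qed

lemma free_hyperbolic_invertible:
  assumes "finite I"
  shows "invertible_form A (direct_sum (free_rmod A I) (dual A (free_rmod A I))) (hyperbolic_form A)"
proof (rule hyperbolic_invertible[OF free_right_module assms])
  \<comment> \<open>The coordinates are dual to the unit vectors; the restriction makes them
    extensional, as membership in \<open>dual\<close> demands.\<close>
  let ?q = "\<lambda>i. \<lambda>u\<in>carrier (free_rmod A I). u i"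
  interpret F: right_module A "free_rmod A I" by (rule free_right_module)
  show "unit_vector I \<in> I \<rightarrow> carrier (free_rmod A I)"
    by (simp add: unit_vector_closed)
  show "?q \<in> I \<rightarrow> carrier (dual A (free_rmod A I))"
    using free_rmod_coordinate_hom[THEN rmod_homD(1)] free_rmod_coordinate_hom[THEN rmod_homD(2)]
      free_rmod_coordinate_hom[THEN rmod_homD(3)]
    by (auto intro!: dualI simp: F.ract_closed) (auto simp: self_rmod_def)
  fix u assume u: "u \<in> carrier (free_rmod A I)"
  then show "u = (\<Oplus>\<^bsub>free_rmod A I\<^esub>j\<in>I. unit_vector I j \<cdot>\<^bsub>free_rmod A I\<^esub> ?q j u)"
    using free_rmod_expansion[OF u assms] by simp
qed

end

section \<open>Embedding a hermitian module with a finite dual basis\<close>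

text \<open>The dual basis says that \<open>s\<close>, the vector of coordinates, is a section of
  \<open>\<pi>\<close>. The functional \<open>\<omega> x\<close> depends linearly on
  \<open>x\<close> because \<open>h\<close> pulls scalars out of its first argument through the
  star, exactly as the twisted action does.\<close>

lemma (in hermitian_module) isometric_embedding_hyperbolic:
  assumes I: "finite I" and e: "e \<in> I \<rightarrow> carrier M"
    and q: "\<And>i. i \<in> I \<Longrightarrow> q i \<in> rmod_hom A M (self_rmod A)"
    and basis: "\<And>m. m \<in> carrier M \<Longrightarrow> m = (\<Oplus>\<^bsub>M\<^esub>i\<in>I. e i \<cdot>\<^bsub>M\<^esub> q i m)"
  obtains \<phi> where "\<phi> \<in> rmod_hom A M (direct_sum (free_rmod A I) (dual A (free_rmod A I)))"
    and "\<And>x y. \<lbrakk>x \<in> carrier M; y \<in> carrier M\<rbrakk> \<Longrightarrow> hyperbolic_form A (\<phi> x) (\<phi> y) = h x y"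
proof -
  let ?F = "free_rmod A I"
  interpret F: right_module A ?F by (rule free_right_module)
  define \<pi> where "\<pi> = (\<lambda>u. \<Oplus>\<^bsub>M\<^esub>i\<in>I. e i \<cdot>\<^bsub>M\<^esub> u i)"
  define s where "s = (\<lambda>m. \<lambda>i\<in>I. q i m)"
  \<comment> \<open>The factor \<open>1/2\<close> compensates for both summands of the hyperbolic form contributing \<open>h x y\<close>.\<close>
  define \<omega> where "\<omega> = (\<lambda>x. \<lambda>u\<in>carrier ?F. (1/2) \<odot>\<^bsub>A\<^esub> h x (\<pi> u))"
  have uc: "u i \<in> carrier A" if "u \<in> carrier ?F" "i \<in> I" for u i
    using that by (auto simp: free_rmod_def)
  have eu: "(\<lambda>i. e i \<cdot>\<^bsub>M\<^esub> u i) \<in> I \<rightarrow> carrier M" if "u \<in> carrier ?F" for u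
    using e uc that by (auto intro!: ract_closed)
  have \<pi>: "\<pi> u \<in> carrier M" if "u \<in> carrier ?F" for u
    unfolding \<pi>_def using eu[OF that] by (rule M.finsum_closed)
  have \<pi>_add: "\<pi> (u \<oplus>\<^bsub>?F\<^esub> v) = \<pi> u \<oplus>\<^bsub>M\<^esub> \<pi> v" if "u \<in> carrier ?F" "v \<in> carrier ?F" for u v
  proof -
    have "\<pi> (u \<oplus>\<^bsub>?F\<^esub> v) = (\<Oplus>\<^bsub>M\<^esub>i\<in>I. e i \<cdot>\<^bsub>M\<^esub> u i \<oplus>\<^bsub>M\<^esub> e i \<cdot>\<^bsub>M\<^esub> v i)"
      unfolding \<pi>_def using e uc that eu
      by (intro M.finsum_cong') (auto simp: free_rmod_def ract_add_scalar Pi_iff)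
    also have "\<dots> = \<pi> u \<oplus>\<^bsub>M\<^esub> \<pi> v"
      unfolding \<pi>_def using eu that by (intro M.finsum_addf) auto
    finally show ?thesis .
  qed
  have \<pi>_ract: "\<pi> (u \<cdot>\<^bsub>?F\<^esub> a) = \<pi> u \<cdot>\<^bsub>M\<^esub> a" if u: "u \<in> carrier ?F" and a: "a \<in> carrier A" for u a
  proof -
    interpret act: abelian_group_hom M M "\<lambda>m. m \<cdot>\<^bsub>M\<^esub> a"
      using a by (intro abelian_group_hom_if_additive M.abelian_group_axioms)
        (auto simp: ract_closed ract_add)
    have "\<pi> (u \<cdot>\<^bsub>?F\<^esub> a) = (\<Oplus>\<^bsub>M\<^esub>i\<in>I. e i \<cdot>\<^bsub>M\<^esub> u i \<cdot>\<^bsub>M\<^esub> a)"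
      unfolding \<pi>_def using e uc u a eu[OF u]
      by (intro M.finsum_cong') (auto simp: free_rmod_def ract_assoc Pi_iff intro!: ract_closed)
    also have "\<dots> = \<pi> u \<cdot>\<^bsub>M\<^esub> a"
      unfolding \<pi>_def using I eu[OF u] by (rule act.hom_finsum[symmetric])
    finally show ?thesis .
  qed
  note qD = rmod_homD[OF q, simplified self_rmod_def, simplified]
  have s: "s x \<in> carrier ?F" if "x \<in> carrier M" for x
    using that I qD(1) by (auto simp: s_def free_rmod_def)
  have \<pi>s: "\<pi> (s x) = x" if "x \<in> carrier M" for x
  proof -
    have "\<pi> (s x) = (\<Oplus>\<^bsub>M\<^esub>i\<in>I. e i \<cdot>\<^bsub>M\<^esub> q i x)"
      unfolding \<pi>_def s_def using e qD(1) that
      by (intro M.finsum_cong') (auto intro!: ract_closed)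
    then show ?thesis
      using basis[OF that] by simp
  qed
  have \<omega>: "\<omega> x \<in> carrier (dual A ?F)" if "x \<in> carrier M" for x
    using that by (intro dualI)
      (auto simp: \<omega>_def \<pi> \<pi>_add \<pi>_ract form_closed form_add_right form_ract smult_closed
        smult_r_distr smult_assoc2 F.ract_closed)
  \<comment> \<open>The scalar is real, hence fixed by \<open>cnj\<close>.\<close>
  have half: "star A ((1/2) \<odot>\<^bsub>A\<^esub> a) = (1/2) \<odot>\<^bsub>A\<^esub> star A a" if "a \<in> carrier A" for a
    using star_smult[OF that, of "1/2"] by simp
  show ?thesis
  proof (rule that[of "\<lambda>x. (s x, \<omega> x)"])
    have "s (x \<oplus>\<^bsub>M\<^esub> y) = s x \<oplus>\<^bsub>?F\<^esub> s y" if "x \<in> carrier M" "y \<in> carrier M" for x y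
      using that qD(2) by (auto simp: s_def free_rmod_def)
    moreover have "s (x \<cdot>\<^bsub>M\<^esub> a) = s x \<cdot>\<^bsub>?F\<^esub> a" if "x \<in> carrier M" "a \<in> carrier A" for x a
      using that qD(3) by (auto simp: s_def free_rmod_def)
    moreover have "\<omega> (x \<oplus>\<^bsub>M\<^esub> y) = \<omega> x \<oplus>\<^bsub>dual A ?F\<^esub> \<omega> y" if "x \<in> carrier M" "y \<in> carrier M" for x y
      using that by (auto simp: \<omega>_def dual_simps form_add \<pi> form_closed smult_r_distr)
    moreover have "\<omega> (x \<cdot>\<^bsub>M\<^esub> a) = \<omega> x \<cdot>\<^bsub>dual A ?F\<^esub> a" if "x \<in> carrier M" "a \<in> carrier A" for x a
      using that
      by (auto simp: \<omega>_def dual_simps form_ract_left \<pi> form_closed smult_assoc3 star_closed)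
    ultimately show "(\<lambda>x. (s x, \<omega> x)) \<in> rmod_hom A M (direct_sum ?F (dual A ?F))"
      using s \<omega> by (intro rmod_homI) (auto simp: direct_sum_def)
  next
    fix x y assume xy: "x \<in> carrier M" "y \<in> carrier M"
    \<comment> \<open>The first summand is the star of half of \<open>h y (\<pi> (s x))\<close>,
      that is of \<open>h y x\<close>; hermitian symmetry makes it agree with the second.\<close>
    have "hyperbolic_form A (s x, \<omega> x) (s y, \<omega> y) = (1/2) \<odot>\<^bsub>A\<^esub> h x y \<oplus>\<^bsub>A\<^esub> (1/2) \<odot>\<^bsub>A\<^esub> h x y"
      using xy by (simp add: hyperbolic_form_def \<omega>_def s \<pi>s half form_closed form_star)
    also have "\<dots> = (1/2 + 1/2) \<odot>\<^bsub>A\<^esub> h x y"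
      using xy by (intro smult_l_distr[symmetric] form_closed)
    also have "\<dots> = h x y"
      using xy by (simp add: smult_one form_closed)
    finally show "hyperbolic_form A (s x, \<omega> x) (s y, \<omega> y) = h x y" .
  qed
qed

theorem theorem2p10:
  fixes A :: "'a star_algebra" and M :: "('a, 'm) rmodule"
    and h' :: "'m \<Rightarrow> 'm \<Rightarrow> 'a" and n :: nat
  assumes "star_algebra A"
    and "regular_hermitian_module A M h'"
    and "generated_by A M n"
  shows "hermitian_module A (hyperbolic_rmod A n) (hyperbolic_form A)
    \<and> invertible_form A (hyperbolic_rmod A n) (hyperbolic_form A)
    \<and> (\<exists>p. rmod_projection A (hyperbolic_rmod A n) p
         \<and> orthogonal_endo (hyperbolic_rmod A n) (hyperbolic_form A) p
         \<and> isometric A (image_rmod p (hyperbolic_rmod A n)) (hyperbolic_form A) M h')"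
proof -
  have M: "hermitian_module A M h'" "projective A M" "invertible_form A M h'"
    using assms(2) by (auto simp: regular_hermitian_module_def)
  interpret M: hermitian_module A M h' by (rule M)
  have H: "hermitian_module A (hyperbolic_rmod A n) (hyperbolic_form A)"
    unfolding hyperbolic_rmod_def by (intro M.hyperbolic_hermitian M.free_right_module)
  obtain e where e: "e \<in> {..<n} \<rightarrow> carrier M"
    and gen: "\<And>m. m \<in> carrier M \<Longrightarrow>
      \<exists>a \<in> {..<n} \<rightarrow> carrier A. m = (\<Oplus>\<^bsub>M\<^esub>i\<in>{..<n}. e i \<cdot>\<^bsub>M\<^esub> a i)"
    using assms(3) unfolding generated_by_def by blast
  \<comment> \<open>Keeping the given generators as the vectors of the dual basis places the
    coordinates in the free module of rank exactly \<open>n\<close>.\<close>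
  obtain q where q: "\<And>k. k \<in> {..<n} \<Longrightarrow> q k \<in> rmod_hom A M (self_rmod A)"
    and basis: "\<And>m. m \<in> carrier M \<Longrightarrow> m = (\<Oplus>\<^bsub>M\<^esub>k\<in>{..<n}. e k \<cdot>\<^bsub>M\<^esub> q k m)"
    using M.projective_dual_basis[OF M(2) e finite_lessThan gen] by blast
  obtain \<phi> where "\<phi> \<in> rmod_hom A M (hyperbolic_rmod A n)"
    and "\<And>x y. \<lbrakk>x \<in> carrier M; y \<in> carrier M\<rbrakk> \<Longrightarrow> hyperbolic_form A (\<phi> x) (\<phi> y) = h' x y"
    using M.isometric_embedding_hyperbolic[OF finite_lessThan e q basis]
    unfolding hyperbolic_rmod_def by blast
  then have "\<exists>p. rmod_projection A (hyperbolic_rmod A n) p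
      \<and> orthogonal_endo (hyperbolic_rmod A n) (hyperbolic_form A) p
      \<and> isometric A (image_rmod p (hyperbolic_rmod A n)) (hyperbolic_form A) M h'"
    using isometric_embedding_imp_orthogonal_projection[OF H M(1) M(3)] by metis
  moreover have "invertible_form A (hyperbolic_rmod A n) (hyperbolic_form A)"
    unfolding hyperbolic_rmod_def by (intro M.free_hyperbolic_invertible finite_lessThan)
  ultimately show ?thesis
    using H by blast
qed

end
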